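(* Fix a real number $c>0$ and integers $\mathsf{t}\ge 1$, $\ell\ge 1$. For $n>c$, consider a half-product code with $n$ component codes, each correcting all erasure patterns of weight at most $\mathsf{t}$, transmitted over the binary erasure channel with erasure probability $p=c/n$ and decoded with $\ell$ iterations of the (parallel) iterative bounded-distance decoder. Let $W_k$, $k\in\{1,\dots,n\}$, be the indicator random variable of the event that the $k$-th component code declares a decoding failure after $\ell$ iterations of decoding, and let $W=\frac1n\sum_{k=1}^n W_k$ be the fraction of failed component codes. Let $z^{(\ell)}=\Psi_{\ge \mathsf{t}+1}(c\,x^{(\ell-1)})$, where $x^{(0)}=1$ and $x^{(j)}=\Psi_{\ge \mathsf{t}}(c\,x^{(j-1)})$ for $j\ge 1$. Then $$\lim_{n\to\infty}\mathbb{E}[W]=z^{(\ell)}.$$ Furthermore, for any $\varepsilon>0$ there exist $\delta>0$, $\beta>0$ and $n_0\in\mathbb{N}$ such that for all $n>n_0$ $$\mathbb{P}\big(|W-\mathbb{E}[W]|\ge\varepsilon\big)\le e^{-\beta n^{\delta}}.$$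
   Context: Notation: $\Psi_{\ge s}(\lambda)=\mathbb{P}(X\ge s)=1-\sum_{i=0}^{s-1}\frac{\lambda^i}{i!}e^{-\lambda}$ where $X$ is Poisson with mean $\lambda$. Half-product code: the Tanner graph is obtained from the complete graph on $n$ vertices by interpreting each vertex as a constraint node (component code) and each of the $m=\binom n2$ edges as a variable node (code bit) participating in the two component codes at its endpoints. Each component code can correct every erasure pattern of weight at most $\mathsf{t}$ among its $n-1$ bits and declares a failure if the weight exceeds $\mathsf{t}$. Channel: each of the $m$ bits is erased independently with probability $p=c/n$. The residual graph $G$ is the graph on the $n$ constraint nodes whose edges are the erased bits; thus $G$ is an Erdős–Rényi random graph $\mathcal{G}(n,c/n)$. Iterative decoding is equivalent to the following parallel peeling procedure on the residual graph: in each iteration, determine all vertices which have degree at most $\mathsf{t}$ in the current graph and remove all of them simultaneously, together with all their adjacent edges. $W_k=1$ (the $k$-th component code declares a failure after $\ell$ iterations) if and only if vertex $k$ has not been removed during the first $\ell$ iterations. *)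

theory Defs
  imports "HOL-Probability.Probability"
begin

definition poisson_tail :: "nat \<Rightarrow> real \<Rightarrow> real" where
  "poisson_tail s \<mu> = 1 - (\<Sum>i<s. \<mu> ^ i / fact i * exp (- \<mu>))"

lemma poisson_tail_eq_prob:
  assumes "0 < \<mu>"
  shows "poisson_tail s \<mu> = measure_pmf.prob (poisson_pmf \<mu>) {x. s \<le> x}"
proof -
  have "{x. s \<le> x} = UNIV - {..<s}" by auto
  moreover have "measure_pmf.prob (poisson_pmf \<mu>) {..<s} = (\<Sum>i<s. pmf (poisson_pmf \<mu>) i)"
    by (rule measure_measure_pmf_finite) simp
  ultimately show ?thesis
    using assms measure_pmf.prob_compl[of "{..<s}" "poisson_pmf \<mu>"]
    by (simp add: poisson_tail_def)
qed

text \<open>The density evolution recursion.\<close>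

primrec de_x :: "real \<Rightarrow> nat \<Rightarrow> nat \<Rightarrow> real" where
  "de_x c t 0 = 1"
| "de_x c t (Suc j) = poisson_tail t (c * de_x c t j)"

text \<open>The index \<open>l - 1\<close> truncates, so this is only meaningful for \<open>l \<ge> 1\<close>.\<close>

definition de_z :: "real \<Rightarrow> nat \<Rightarrow> nat \<Rightarrow> real" where
  "de_z c t l = poisson_tail (t + 1) (c * de_x c t (l - 1))"

text \<open>
  The half-product code with component codes \<open>{1..n}\<close>: a code bit is an edge of the complete graph
  on \<open>{1..n}\<close>, and it participates in the two component codes which are its endpoints.
\<close>

definition component_codes :: "nat \<Rightarrow> nat set" where
  "component_codes n = {1..n}"

definition code_bits :: "nat \<Rightarrow> nat set set" where
  "code_bits n = {e. e \<subseteq> component_codes n \<and> card e = 2}"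

text \<open>
  The binary erasure channel, as the law of the pattern of erasures, \<open>True\<close> meaning erased; patterns
  have the default value \<open>False\<close> outside the code bits.
  The parameter of \<open>bernoulli_pmf\<close> is clipped to \<open>[0, 1]\<close>, so \<open>p\<close> has to lie in that interval.
\<close>

definition erasure_channel :: "nat \<Rightarrow> real \<Rightarrow> (nat set \<Rightarrow> bool) pmf" where
  "erasure_channel n p = Pi_pmf (code_bits n) False (\<lambda>_. bernoulli_pmf p)"

type_synonym graph = "nat set \<times> nat set set"

definition residual_graph :: "nat \<Rightarrow> (nat set \<Rightarrow> bool) \<Rightarrow> graph" where
  "residual_graph n \<omega> = (component_codes n, {e \<in> code_bits n. \<omega> e})"

definition vertex_degree :: "nat set set \<Rightarrow> nat \<Rightarrow> nat" where
  "vertex_degree E v = card {e \<in> E. v \<in> e}"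

definition peel :: "nat \<Rightarrow> graph \<Rightarrow> graph" where
  "peel t G = (let R = {v \<in> fst G. vertex_degree (snd G) v \<le> t}
               in (fst G - R, {e \<in> snd G. e \<inter> R = {}}))"

definition component_failure :: "nat \<Rightarrow> nat \<Rightarrow> nat \<Rightarrow> nat \<Rightarrow> (nat set \<Rightarrow> bool) \<Rightarrow> real" where
  "component_failure n t l k \<omega> = of_bool (k \<in> fst ((peel t ^^ l) (residual_graph n \<omega>)))"

definition failed_fraction :: "nat \<Rightarrow> nat \<Rightarrow> nat \<Rightarrow> (nat set \<Rightarrow> bool) \<Rightarrow> real" where
  "failed_fraction n t l \<omega> = (\<Sum>k\<in>component_codes n. component_failure n t l k \<omega>) / real n"

text \<open>
  Agreement with the decoder described on the code bits: in each iteration a bit stays erased iff both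
  of its component codes see more than \<open>t\<close> erasures, and a component code fails after \<open>l\<close> iterations
  iff it sees more than \<open>t\<close> erasures at the start of the last iteration.
\<close>

definition decode_round :: "nat \<Rightarrow> nat set set \<Rightarrow> nat set set" where
  "decode_round t E = {e \<in> E. \<forall>k\<in>e. t < vertex_degree E k}"

lemma peel_pair:
  "peel t (V, E) = (V - {v \<in> V. vertex_degree E v \<le> t},
     {e \<in> E. e \<inter> {v \<in> V. vertex_degree E v \<le> t} = {}})"
  by (simp add: peel_def Let_def)

lemma snd_peel_iterate:
  assumes "\<forall>e\<in>E. e \<subseteq> V"
  shows "snd ((peel t ^^ l) (V, E)) = (decode_round t ^^ l) E
    \<and> (\<forall>e \<in> (decode_round t ^^ l) E. e \<subseteq> fst ((peel t ^^ l) (V, E)))"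
proof (induction l)
  case 0
  then show ?case using assms by simp
next
  case (Suc l)
  obtain V' E' where G: "(peel t ^^ l) (V, E) = (V', E')" by fastforce
  from Suc have E': "(decode_round t ^^ l) E = E'" and sub: "\<forall>e\<in>E'. e \<subseteq> V'"
    by (simp_all add: G)
  have "{e \<in> E'. e \<inter> {v \<in> V'. vertex_degree E' v \<le> t} = {}} = decode_round t E'"
    using sub unfolding decode_round_def by fastforce
  moreover have "\<forall>e \<in> decode_round t E'. e \<subseteq> V' - {v \<in> V'. vertex_degree E' v \<le> t}"
    using sub unfolding decode_round_def by fastforce
  ultimately show ?case by (simp add: G E' peel_pair)
qed

lemma degree_decode_iterate_mono:
  assumes "finite E" "i \<le> j"
  shows "vertex_degree ((decode_round t ^^ j) E) k \<le> vertex_degree ((decode_round t ^^ i) E) k"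
proof -
  have sub: "(decode_round t ^^ j) E \<subseteq> (decode_round t ^^ i) E"
    using assms(2) by (induction rule: dec_induct) (auto simp: decode_round_def)
  have "(decode_round t ^^ i) E \<subseteq> E" for i by (induction i) (auto simp: decode_round_def)
  then have "finite ((decode_round t ^^ i) E)" using assms(1) finite_subset by blast
  then show ?thesis unfolding vertex_degree_def using sub by (intro card_mono) auto
qed

lemma component_failure_Suc:
  "component_failure n t (Suc l) k \<omega> =
     of_bool (k \<in> component_codes n \<and>
              t < vertex_degree ((decode_round t ^^ l) {e \<in> code_bits n. \<omega> e}) k)"
proof -
  let ?V = "component_codes n" and ?E = "{e \<in> code_bits n. \<omega> e}"
  have sub: "\<forall>e\<in>?E. e \<subseteq> ?V" by (auto simp: code_bits_def)
  have fin: "finite ?E"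
    by (rule finite_subset[of _ "Pow ?V"]) (auto simp: code_bits_def component_codes_def)
  have "k \<in> fst ((peel t ^^ Suc l) (?V, ?E)) \<longleftrightarrow>
          k \<in> ?V \<and> t < vertex_degree ((decode_round t ^^ l) ?E) k" for l
  proof (induction l)
    case 0
    then show ?case by (auto simp: peel_pair)
  next
    case (Suc l)
    obtain V' E' where G: "(peel t ^^ Suc l) (?V, ?E) = (V', E')" by fastforce
    then have E': "(decode_round t ^^ Suc l) ?E = E'"
      using snd_peel_iterate[OF sub, where t = t and l = "Suc l"] by simp
    have "(peel t ^^ Suc (Suc l)) (?V, ?E) = peel t (V', E')"
      using G by simp
    then have "k \<in> fst ((peel t ^^ Suc (Suc l)) (?V, ?E)) \<longleftrightarrow>
        k \<in> fst ((peel t ^^ Suc l) (?V, ?E)) \<and> t < vertex_degree ((decode_round t ^^ Suc l) ?E) k"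
      unfolding E' G by (auto simp: peel_pair)
    then show ?case
      using Suc degree_decode_iterate_mono[OF fin, where i = l and j = "Suc l" and t = t and k = k]
      by (auto simp del: funpow.simps)
  qed
  then show ?thesis unfolding component_failure_def residual_graph_def by simp
qed

end

theory Submission
  imports Defs "HOL-Real_Asymp.Real_Asymp"
begin

text \<open>
  Instead of comparing neighbourhoods with branching processes, we use a cavity argument: the messages
  sent to a vertex \<open>v\<close> are computed in the graph with \<open>v\<close> deleted, hence are independent of the edges
  at \<open>v\<close>, and they agree with peeling unless there is a short cycle near \<open>v\<close>, which has probability
  \<open>O(1/n)\<close>. Given the graph without \<open>v\<close>, the number of messages which \<open>v\<close> receives is binomial, hence
  nearly Poisson. The density evolution recursion follows once the fraction of vertices that send a
  message concentrates; for this we bound its mean square deviation by induction on the number of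
  iterations, deleting two vertices at a time, which makes their messages conditionally independent.

  For the exponential concentration we delete all edges at vertices of degree greater than
  \<open>D = n\<^sup>a\<close> with a small \<open>a > 0\<close>. This changes the outcome with probability at most
  \<open>n exp (2c - D)\<close>, and afterwards the number of failures is a function of the
  erasures that changes by at most \<open>O(D\<^sup>l\<^sup>+\<^sup>1)\<close> if one bit is flipped.
\<close>

subsection \<open>Independent Bernoulli variables\<close>

text \<open>The recursion does not close in expectation: the fraction of senders enters the Poisson
  tail nonlinearly, so this fraction itself, and not only its mean, has to be near its limit. Mean
  square is the right strength, because it involves only pairs of vertices. Once \<open>u\<close>
  and \<open>v\<close> are deleted, both listen to the same senders along disjoint sets of edges;
  the conditional expectation of the product of their deviations is therefore a square, and this
  square is controlled by the deviation of a fraction of senders one iteration earlier, with two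
  more vertices deleted. The constants depend on the number of deleted vertices but not on
  \<open>n\<close>, so the induction survives a fixed number of iterations.

  For the concentration, two demands on \<open>D\<close> compete: \<open>exp (- D)\<close> has to
  beat the factor \<open>n\<close>, while the effect of one bit, a power of \<open>D\<close>, has to
  stay well below \<open>sqrt n\<close>. A small power of \<open>n\<close> meets both, and it is the
  reason why the bound obtained is a stretched exponential.\<close>

abbreviation bern :: "'a set \<Rightarrow> real \<Rightarrow> ('a \<Rightarrow> bool) pmf" where
  "bern I p \<equiv> Pi_pmf I False (\<lambda>_. bernoulli_pmf p)"

abbreviation expect :: "'a set \<Rightarrow> real \<Rightarrow> (('a \<Rightarrow> bool) \<Rightarrow> real) \<Rightarrow> real" where
  "expect I p f \<equiv> measure_pmf.expectation (bern I p) f"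

text \<open>Locality is stated for all patterns, without reference to the measure, so that
  independence can be read off from the edges which a recursion inspects.\<close>

definition depends_on :: "(('a \<Rightarrow> bool) \<Rightarrow> 'b) \<Rightarrow> 'a set \<Rightarrow> bool" where
  "depends_on f B \<longleftrightarrow> (\<forall>w w'. (\<forall>e\<in>B. w e = w' e) \<longrightarrow> f w = f w')"

lemma depends_onI:
  "(\<And>w w'. (\<And>e. e \<in> B \<Longrightarrow> w e = w' e) \<Longrightarrow> f w = f w') \<Longrightarrow> depends_on f B"
  unfolding depends_on_def by blast

lemma depends_onD: "depends_on f B \<Longrightarrow> (\<And>e. e \<in> B \<Longrightarrow> w e = w' e) \<Longrightarrow> f w = f w'"
  unfolding depends_on_def by blast

lemma depends_on_mono: "depends_on f B \<Longrightarrow> B \<subseteq> C \<Longrightarrow> depends_on f C"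
  unfolding depends_on_def by blast

lemma depends_on_comp: "depends_on f B \<Longrightarrow> depends_on (\<lambda>w. h (f w)) B"
  unfolding depends_on_def by metis

lemma depends_on_comp2:
  "depends_on f B \<Longrightarrow> depends_on g B \<Longrightarrow> depends_on (\<lambda>w. h (f w) (g w)) B"
  unfolding depends_on_def by metis

lemma finite_set_bern:
  assumes "finite I"
  shows "finite (set_pmf (bern I p))"
proof (rule finite_subset)
  show "set_pmf (bern I p) \<subseteq> PiE_dflt I False (\<lambda>_. UNIV)"
    using set_Pi_pmf_subset'[OF assms] by (fastforce simp: PiE_dflt_def)
qed (use assms in auto)

lemma integrable_bern [simp]:
  fixes f :: "('a \<Rightarrow> bool) \<Rightarrow> real"
  shows "finite I \<Longrightarrow> integrable (measure_pmf (bern I p)) f"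
  by (intro integrable_measure_pmf_finite finite_set_bern)

lemma expect_mono:
  assumes "finite I" "\<And>w. f w \<le> g w"
  shows "expect I p f \<le> expect I p g"
  using assms by (intro integral_mono) auto

lemma expect_sum:
  assumes "finite I"
  shows "expect I p (\<lambda>w. \<Sum>x\<in>X. f x w) = (\<Sum>x\<in>X. expect I p (f x))"
  using assms by (intro Bochner_Integration.integral_sum) auto

lemma prob_eq_expect:
  "measure_pmf.prob M {w. P w} = measure_pmf.expectation M (\<lambda>w. of_bool (P w))"
proof -
  have "(\<lambda>w. of_bool (P w) :: real) = indicator {w. P w}" by (auto simp: indicator_def)
  then show ?thesis by simp
qed

lemma expectation_pair_pmf_mult:
  fixes f :: "'a \<Rightarrow> real" and g :: "'b \<Rightarrow> real"
  assumes "finite (set_pmf M)" "finite (set_pmf N)"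
  shows "measure_pmf.expectation (pair_pmf M N) (\<lambda>(x, y). f x * g y) =
         measure_pmf.expectation M f * measure_pmf.expectation N g"
proof -
  have "measure_pmf.expectation (pair_pmf M N) (\<lambda>(x, y). f x * g y) =
        (\<Sum>(x,y)\<in>set_pmf M \<times> set_pmf N. (f x * g y) * pmf (pair_pmf M N) (x, y))"
    using assms by (subst integral_measure_pmf_real[where A = "set_pmf M \<times> set_pmf N"])
      (auto simp: case_prod_unfold)
  also have "\<dots> = (\<Sum>(x,y)\<in>set_pmf M \<times> set_pmf N. (f x * pmf M x) * (g y * pmf N y))"
    by (intro sum.cong) (auto simp: pmf_pair)
  also have "\<dots> = (\<Sum>x\<in>set_pmf M. f x * pmf M x) * (\<Sum>y\<in>set_pmf N. g y * pmf N y)"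
    by (simp add: sum_product sum.cartesian_product)
  also have "\<dots> = measure_pmf.expectation M f * measure_pmf.expectation N g"
    using assms by (simp add: integral_measure_pmf_real[where A = "set_pmf M"]
        integral_measure_pmf_real[where A = "set_pmf N"])
  finally show ?thesis .
qed

text \<open>The coordinates in \<open>B\<close> and those outside \<open>B\<close> form an
  independent pair; \<open>f\<close> reads only the first component and \<open>g\<close> only the
  second. \<open>B\<close> and \<open>C\<close> may leave \<open>I\<close>, since patterns in the
  support have the default \<open>False\<close> there.\<close>

lemma expect_indep:
  assumes "finite I" "depends_on f B" "depends_on g C" "B \<inter> C = {}"
  shows "expect I p (\<lambda>w. f w * g w) = expect I p f * expect I p g"
proof -
  let ?J = "I \<inter> B" and ?K = "I - B"
  let ?h = "\<lambda>(w, w') x. if x \<in> ?J then w x else w' x :: bool"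
  have fin: "finite ?J" "finite ?K" using assms(1) by auto
  have "?J \<union> ?K = I" by auto
  then have split: "bern I p = map_pmf ?h (pair_pmf (bern ?J p) (bern ?K p))"
    using Pi_pmf_union[OF fin, of False "\<lambda>_. bernoulli_pmf p"] by (simp add: Diff_disjoint disjoint_iff)
  let ?P = "pair_pmf (bern ?J p) (bern ?K p)"
  have out: "y e = False" if "x \<in> set_pmf (bern X p)" "e \<notin> X" "finite X" "y = x" for X x y e
    using set_Pi_pmf_subset[of X False "\<lambda>_. bernoulli_pmf p"] that by auto
  have f: "f (?h z) = f (fst z)" if "z \<in> set_pmf ?P" for z
  proof (rule depends_onD[OF assms(2)])
    fix e assume "e \<in> B"
    then show "?h z e = fst z e"
      using that out[of "fst z" ?J e] out[of "snd z" ?K e] fin by (auto simp: case_prod_unfold)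
  qed
  have g: "g (?h z) = g (snd z)" if "z \<in> set_pmf ?P" for z
  proof (rule depends_onD[OF assms(3)])
    fix e assume "e \<in> C"
    then show "?h z e = snd z e" using assms(4) by (auto simp: case_prod_unfold)
  qed
  have E: "expect I p k = measure_pmf.expectation ?P k'"
    if "\<And>z. z \<in> set_pmf ?P \<Longrightarrow> k (?h z) = k' z" for k k'
    unfolding split integral_map_pmf
    by (intro integral_cong_AE) (use that in \<open>auto simp: AE_measure_pmf_iff\<close>)
  have "expect I p (\<lambda>w. f w * g w) = measure_pmf.expectation ?P (\<lambda>(x, y). f x * g y)"
  proof (rule E)
    fix z assume "z \<in> set_pmf ?P"
    then show "f (?h z) * g (?h z) = (case z of (x, y) \<Rightarrow> f x * g y)"
      unfolding f[OF \<open>z \<in> set_pmf ?P\<close>] g[OF \<open>z \<in> set_pmf ?P\<close>] by (simp add: case_prod_unfold)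
  qed
  also have "\<dots> = expect ?J p f * expect ?K p g"
    by (rule expectation_pair_pmf_mult) (intro finite_set_bern fin)+
  also have "expect ?J p f = measure_pmf.expectation ?P (\<lambda>z. f (fst z))"
    by (subst map_fst_pair_pmf[of "bern ?J p" "bern ?K p", symmetric]) simp
  also have "\<dots> = expect I p f" by (rule E[symmetric]) (simp only: f)
  also have "expect ?K p g = measure_pmf.expectation ?P (\<lambda>z. g (snd z))"
    by (subst map_snd_pair_pmf[of "bern ?J p" "bern ?K p", symmetric]) simp
  also have "\<dots> = expect I p g" by (rule E[symmetric]) (simp only: g)
  finally show ?thesis .
qed

lemma expect_coordinate:
  assumes "finite I" "e \<in> I" "0 \<le> p" "p \<le> 1"
  shows "expect I p (\<lambda>w. of_bool (w e)) = p"
proof -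
  have "expect I p (\<lambda>w. of_bool (w e)) =
        measure_pmf.expectation (map_pmf (\<lambda>w. w e) (bern I p)) of_bool" by simp
  also have "map_pmf (\<lambda>w. w e) (bern I p) = bernoulli_pmf p"
    using assms by (subst Pi_pmf_component) auto
  finally show ?thesis using assms by simp
qed

text \<open>Conditioning on the random set \<open>Y\<close> by splitting into the finitely many
  events \<open>Y w = y\<close>, each of which is independent of the fixed function
  \<open>G y\<close>. In the applications \<open>Y\<close> is the set of senders and
  \<open>G y\<close> a function of the edges between deleted vertices and \<open>y\<close>.\<close>

lemma expect_substitute:
  assumes "finite I" "finite W" "\<And>w. Y w \<subseteq> W" "depends_on Y C"
    and "\<And>y. y \<subseteq> W \<Longrightarrow> depends_on (G y) B" "B \<inter> C = {}"
    and "\<And>y. y \<subseteq> W \<Longrightarrow> expect I p (G y) = h y"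
  shows "expect I p (\<lambda>w. G (Y w) w) = expect I p (\<lambda>w. h (Y w))"
proof -
  have pick: "k (Y w) = (\<Sum>y\<in>Pow W. k y * of_bool (Y w = y))" for k :: "_ \<Rightarrow> real" and w
    using assms(2) assms(3)[of w]
    by (subst sum.mono_neutral_right[where S = "{Y w}"]) (auto simp: assms(3))
  have "expect I p (\<lambda>w. G (Y w) w) =
      expect I p (\<lambda>w. \<Sum>y\<in>Pow W. G y w * of_bool (Y w = y))"
    by (rule Bochner_Integration.integral_cong) (simp_all add: pick[of "\<lambda>y. G y w" w for w])
  also have "\<dots> = (\<Sum>y\<in>Pow W. expect I p (\<lambda>w. G y w * of_bool (Y w = y)))"
    by (rule expect_sum[OF assms(1)])
  also have "\<dots> = (\<Sum>y\<in>Pow W. expect I p (\<lambda>w. h y * of_bool (Y w = y)))"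
  proof (rule sum.cong)
    fix y assume y: "y \<in> Pow W"
    have "depends_on (\<lambda>w. of_bool (Y w = y) :: real) C"
      by (intro depends_onI) (use depends_onD[OF assms(4)] in \<open>metis\<close>)
    then have "expect I p (\<lambda>w. G y w * of_bool (Y w = y)) =
        expect I p (G y) * expect I p (\<lambda>w. of_bool (Y w = y))"
      using expect_indep[OF assms(1) assms(5)] y assms(6) by blast
    then show "expect I p (\<lambda>w. G y w * of_bool (Y w = y)) =
        expect I p (\<lambda>w. h y * of_bool (Y w = y))"
      using assms(7) y by auto
  qed simp
  also have "\<dots> = expect I p (\<lambda>w. \<Sum>y\<in>Pow W. h y * of_bool (Y w = y))"
    by (rule expect_sum[OF assms(1), symmetric])
  also have "\<dots> = expect I p (\<lambda>w. h (Y w))" by (simp add: pick[symmetric])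
  finally show ?thesis .
qed

section \<open>Exponential moments of functions with bounded differences\<close>

lemma exp_le_1_plus_sq:
  fixes x :: real
  assumes "\<bar>x\<bar> \<le> 1"
  shows "exp x \<le> 1 + x + x\<^sup>2"
proof (cases "x \<ge> 0")
  case True then show ?thesis using exp_bound[of x] assms by simp
next
  case False
  define y where "y = - x"
  have y: "0 \<le> y" "y \<le> 1" using False assms by (auto simp: y_def)
  \<comment> \<open>The claim for \<open>x = - y\<close> is equivalent to
    \<open>1 \<le> (1 - y + y^2) * exp y\<close>, and the quadratic Taylor polynomial is a lower
    bound for \<open>exp y\<close>.\<close>
  have "1 \<le> (1 - y + y\<^sup>2) * (1 + y + y\<^sup>2 / 2)"
  proof -
    have "(1 - y + y\<^sup>2) * (1 + y + y\<^sup>2 / 2) = 1 + y\<^sup>2 / 2 + y ^ 3 / 2 + y ^ 4 / 2"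
      by (simp add: field_simps power2_eq_square power3_eq_cube power4_eq_xxxx)
    then show ?thesis using y by simp
  qed
  also have "\<dots> \<le> (1 - y + y\<^sup>2) * exp y"
  proof (rule mult_left_mono)
    show "0 \<le> 1 - y + y\<^sup>2" using y zero_le_power2[of y] by linarith
  qed (use exp_lower_Taylor_quadratic[OF y(1)] in simp)
  finally have "exp (- y) \<le> 1 - y + y\<^sup>2" by (simp add: exp_minus field_simps)
  then show ?thesis by (simp add: y_def)
qed

lemma expect_insert:
  assumes "finite I" "x \<notin> I" "0 \<le> p" "p \<le> 1"
  shows "expect (insert x I) p f =
    expect I p (\<lambda>w. p * f (w(x := True)) + (1 - p) * f (w(x := False)))"
proof -
  have fin: "finite (set_pmf (bern I p))" by (rule finite_set_bern[OF assms(1)])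
  have "bern (insert x I) p =
      bind_pmf (bern I p) (\<lambda>w. map_pmf (\<lambda>b. w(x := b)) (bernoulli_pmf p))"
    unfolding Pi_pmf_insert'[OF assms(1,2)] map_pmf_def by (rule bind_commute_pmf)
  then have "expect (insert x I) p f =
      (\<Sum>w\<in>set_pmf (bern I p). pmf (bern I p) w *\<^sub>R
        measure_pmf.expectation (map_pmf (\<lambda>b. w(x := b)) (bernoulli_pmf p)) f)"
    by (simp only:) (subst pmf_expectation_bind[OF fin], auto)
  also have "\<dots> = expect I p (\<lambda>w. p * f (w(x := True)) + (1 - p) * f (w(x := False)))"
    using assms(3,4) fin
    by (subst integral_measure_pmf_real[where A = "set_pmf (bern I p)"])
      (auto intro!: sum.cong simp: algebra_simps)
  finally show ?thesis .
qed

text \<open>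
  The exponent carries the factor \<open>p\<close>, unlike in the bounded differences inequality: in a sparse
  random graph there are quadratically many coordinates, but \<open>p\<close> is of the order \<open>1 / n\<close>.
\<close>

lemma expect_exp_deviation:
  fixes f :: "('a \<Rightarrow> bool) \<Rightarrow> real"
  assumes "finite I" "0 \<le> p" "p \<le> 1"
    and "\<And>e w. e \<in> I \<Longrightarrow> \<bar>f (w(e := True)) - f (w(e := False))\<bar> \<le> K e"
    and "\<And>e. e \<in> I \<Longrightarrow> K e \<le> 1"
  shows "expect I p (\<lambda>w. exp (f w - expect I p f)) \<le> exp (p * (\<Sum>e\<in>I. (K e)\<^sup>2))"
  using assms
proof (induction I arbitrary: f rule: finite_induct)
  case empty
  then show ?case by simp
next
  case (insert x I)
  \<comment> \<open>One step of the Doob martingale: averaging over the coordinate \<open>x\<close>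
    preserves the mean and the difference bounds in the other coordinates.\<close>
  define g where "g = (\<lambda>w. p * f (w(x := True)) + (1 - p) * f (w(x := False)))"
  note Ei = expect_insert[OF insert.hyps insert.prems(1,2)]
  have Ef: "expect (insert x I) p f = expect I p g" by (simp add: Ei g_def)
  have gK: "\<bar>g (w(e := True)) - g (w(e := False))\<bar> \<le> K e" if "e \<in> I" for e w
  proof -
    have ne: "e \<noteq> x" using that insert.hyps by auto
    let ?a = "f (w(x := True, e := True)) - f (w(x := True, e := False))"
    let ?b = "f (w(x := False, e := True)) - f (w(x := False, e := False))"
    have "\<bar>g (w(e := True)) - g (w(e := False))\<bar> = \<bar>p * ?a + (1 - p) * ?b\<bar>"
      by (simp add: g_def fun_upd_twist[OF ne] algebra_simps)
    also have "\<dots> \<le> p * \<bar>?a\<bar> + (1 - p) * \<bar>?b\<bar>"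
      by (rule order.trans[OF abs_triangle_ineq]) (use insert.prems(1,2) in \<open>simp add: abs_mult\<close>)
    also have "\<dots> \<le> p * K e + (1 - p) * K e"
      using that by (intro add_mono mult_left_mono insert.prems(3)) (simp_all add: insert.prems(1,2))
    finally show ?thesis by (simp add: algebra_simps)
  qed
  have step: "p * exp (f (w(x := True)) - m) + (1 - p) * exp (f (w(x := False)) - m)
      \<le> exp (g w - m) * exp (p * (K x)\<^sup>2)" for w m
  proof -
    define d where "d = f (w(x := True)) - f (w(x := False))"
    have dK: "\<bar>d\<bar> \<le> K x" unfolding d_def by (rule insert.prems(3)) simp
    then have d1: "\<bar>d\<bar> \<le> 1" using insert.prems(4)[of x] by simp
    have p: "0 \<le> p" "p \<le> 1" by fact+
    have "\<bar>(1 - p) * d\<bar> \<le> 1 * 1" unfolding abs_mult using p d1 by (intro mult_mono) auto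
    then have e1: "exp ((1 - p) * d) \<le> 1 + (1 - p) * d + ((1 - p) * d)\<^sup>2"
      by (intro exp_le_1_plus_sq) simp
    have "\<bar>- p * d\<bar> \<le> 1 * 1" unfolding abs_mult using p d1 by (intro mult_mono) auto
    then have e2: "exp (- p * d) \<le> 1 + (- p * d) + (- p * d)\<^sup>2"
      by (intro exp_le_1_plus_sq) simp
    have "p * exp ((1 - p) * d) + (1 - p) * exp (- p * d) \<le>
        p * (1 + (1 - p) * d + ((1 - p) * d)\<^sup>2) + (1 - p) * (1 + (- p * d) + (- p * d)\<^sup>2)"
      using p e1 e2 by (intro add_mono mult_left_mono) auto
    \<comment> \<open>Both outcomes are centred at their mean, so the linear terms cancel and the
      variance \<open>p * (1 - p) * d^2\<close> remains. This is the origin of the factor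
      \<open>p\<close> in the exponent.\<close>
    also have "\<dots> = 1 + p * (1 - p) * d\<^sup>2" by (simp add: algebra_simps power2_eq_square)
    also have "\<dots> \<le> 1 + p * (K x)\<^sup>2"
    proof -
      have "d\<^sup>2 \<le> (K x)\<^sup>2" using dK by (metis abs_le_square_iff abs_of_nonneg abs_ge_zero order.trans)
      then have "p * (1 - p) * d\<^sup>2 \<le> p * 1 * (K x)\<^sup>2" using p by (intro mult_mono) auto
      then show ?thesis by simp
    qed
    also have "\<dots> \<le> exp (p * (K x)\<^sup>2)" by (simp add: exp_ge_add_one_self)
    finally have *: "p * exp ((1 - p) * d) + (1 - p) * exp (- p * d) \<le> exp (p * (K x)\<^sup>2)" .
    have "f (w(x := True)) - m = (g w - m) + (1 - p) * d"
      and "f (w(x := False)) - m = (g w - m) + (- p * d)"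
      by (simp_all add: g_def d_def algebra_simps)
    then have "p * exp (f (w(x := True)) - m) + (1 - p) * exp (f (w(x := False)) - m)
      = exp (g w - m) * (p * exp ((1 - p) * d) + (1 - p) * exp (- p * d))"
      by (simp only: exp_add) (simp add: algebra_simps)
    then show ?thesis using * by simp
  qed
  have "expect (insert x I) p (\<lambda>w. exp (f w - expect (insert x I) p f))
      \<le> expect I p (\<lambda>w. exp (g w - expect I p g) * exp (p * (K x)\<^sup>2))"
    unfolding Ef by (subst Ei) (intro expect_mono insert.hyps step)
  also have "\<dots> = expect I p (\<lambda>w. exp (g w - expect I p g)) * exp (p * (K x)\<^sup>2)" by simp
  also have "\<dots> \<le> exp (p * (\<Sum>e\<in>I. (K e)\<^sup>2)) * exp (p * (K x)\<^sup>2)"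
    by (intro mult_right_mono insert.IH gK insert.prems) simp_all
  also have "\<dots> = exp (p * (\<Sum>e\<in>insert x I. (K e)\<^sup>2))"
    using insert.hyps by (simp add: exp_add[symmetric] algebra_simps)
  finally show ?case .
qed

subsection \<open>Binomial and Poisson tails\<close>

text \<open>The probability of at least \<open>s\<close> successes in \<open>k\<close> trials, by
  conditioning on one trial. Both its appearance in the random graph and its comparison with the
  Poisson tail are inductions along this recursion.\<close>

fun binomial_tail :: "real \<Rightarrow> nat \<Rightarrow> nat \<Rightarrow> real" where
  "binomial_tail p 0 k = 1"
| "binomial_tail p (Suc s) 0 = 0"
| "binomial_tail p (Suc s) (Suc k) = p * binomial_tail p s k + (1 - p) * binomial_tail p (Suc s) k"

text \<open>Injectivity of \<open>h\<close> makes the counted bits distinct coordinates, so that one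
  of them can be split off by independence.\<close>

lemma expect_count_ge:
  fixes h :: "'b \<Rightarrow> 'a"
  assumes "finite I" "finite Y" "inj_on h Y" "h ` Y \<subseteq> I" "0 \<le> p" "p \<le> 1"
  shows "expect I p (\<lambda>w. of_bool (s \<le> card {y \<in> Y. w (h y)})) = binomial_tail p s (card Y)"
  using assms(2-4)
proof (induction Y arbitrary: s rule: finite_induct)
  case empty
  then show ?case by (cases s) auto
next
  case (insert y Y)
  define N where "N w = card {y \<in> Y. w (h y)}" for w :: "'a \<Rightarrow> bool"
  have card: "card {x \<in> insert y Y. w (h x)} = (if w (h y) then Suc (N w) else N w)"
    for w :: "'a \<Rightarrow> bool"
  proof -
    have "{x \<in> insert y Y. w (h x)} =
        (if w (h y) then insert y {x \<in> Y. w (h x)} else {x \<in> Y. w (h x)})" by auto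
    then show ?thesis using insert.hyps by (auto simp: N_def)
  qed
  note IH = insert.IH[folded N_def]
  have hy: "h y \<in> I" "h y \<notin> h ` Y" using insert by auto
  have prems: "inj_on h Y" "h ` Y \<subseteq> I" using insert.prems by auto
  show ?case
  proof (cases s)
    case 0 then show ?thesis by simp
  next
    case (Suc r)
    have dep: "depends_on (\<lambda>w. of_bool (q \<le> N w) :: real) (h ` Y)" for q
    proof (rule depends_onI)
      fix w w' :: "'a \<Rightarrow> bool" assume "\<And>e. e \<in> h ` Y \<Longrightarrow> w e = w' e"
      then have "{y \<in> Y. w (h y)} = {y \<in> Y. w' (h y)}" by auto
      then show "of_bool (q \<le> N w) = (of_bool (q \<le> N w') :: real)" by (simp add: N_def)
    qed
    have dep1: "depends_on (\<lambda>w. of_bool (w (h y)) :: real) {h y}"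
      by (auto intro: depends_onI)
    have dep2: "depends_on (\<lambda>w. 1 - of_bool (w (h y)) :: real) {h y}"
      by (auto intro: depends_onI)
    have E1: "expect I p (\<lambda>w. of_bool (w (h y))) = p"
      by (rule expect_coordinate[OF assms(1) hy(1) assms(5,6)])
    then have E2: "expect I p (\<lambda>w. 1 - of_bool (w (h y))) = 1 - p"
      using assms(1) by simp
    have "expect I p (\<lambda>w. of_bool (s \<le> card {x \<in> insert y Y. w (h x)})) =
        expect I p (\<lambda>w. of_bool (w (h y)) * of_bool (r \<le> N w) +
                        (1 - of_bool (w (h y))) * of_bool (Suc r \<le> N w))"
      unfolding card Suc by (intro Bochner_Integration.integral_cong) auto
    also have "\<dots> = expect I p (\<lambda>w. of_bool (w (h y)) * of_bool (r \<le> N w)) +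
        expect I p (\<lambda>w. (1 - of_bool (w (h y))) * of_bool (Suc r \<le> N w))"
      using assms(1) by (intro Bochner_Integration.integral_add integrable_bern)
    also have "expect I p (\<lambda>w. of_bool (w (h y)) * of_bool (r \<le> N w)) =
        p * binomial_tail p r (card Y)"
      using hy by (subst expect_indep[OF assms(1) dep1 dep]) (simp_all add: E1 IH[OF prems])
    also have "expect I p (\<lambda>w. (1 - of_bool (w (h y))) * of_bool (Suc r \<le> N w)) =
        (1 - p) * binomial_tail p (Suc r) (card Y)"
      using hy by (subst expect_indep[OF assms(1) dep2 dep]) (simp_all only: E2 IH[OF prems], auto)
    finally show ?thesis using insert.hyps by (simp add: Suc)
  qed
qed

lemma poisson_lipschitz_tail_bounds:
  assumes "0 \<le> \<mu>"
  shows "0 \<le> poisson_tail s \<mu>" "poisson_tail s \<mu> \<le> 1"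
proof -
  have "0 \<le> poisson_tail s \<mu> \<and> poisson_tail s \<mu> \<le> 1"
  proof (cases "\<mu> = 0")
    case True
    have "(\<Sum>i<s. (0::real) ^ i / fact i * exp (- 0)) = (\<Sum>i<s. of_bool (i = 0))"
      by (intro sum.cong) (auto simp: power_0_left)
    then show ?thesis using True by (cases s) (auto simp: poisson_tail_def lessThan_Suc_eq_insert_0)
  next
    case False
    then show ?thesis using assms by (simp add: poisson_tail_eq_prob)
  qed
  then show "0 \<le> poisson_tail s \<mu>" "poisson_tail s \<mu> \<le> 1" by auto
qed

text \<open>Shifted by one: the Poisson mass at \<open>s - 1\<close>, and zero for
  \<open>s = 0\<close>. With this shift it is the derivative of \<open>poisson_tail s\<close> in the
  mean.\<close>

definition poisson_density :: "nat \<Rightarrow> real \<Rightarrow> real" where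
  "poisson_density s \<mu> = (case s of 0 \<Rightarrow> 0 | Suc i \<Rightarrow> \<mu> ^ i / fact i * exp (- \<mu>))"

lemma poisson_density_Suc: "poisson_density (Suc s) \<mu> = poisson_tail s \<mu> - poisson_tail (Suc s) \<mu>"
  by (simp add: poisson_tail_def poisson_density_def)

lemma poisson_density_bounds:
  assumes "0 \<le> \<mu>"
  shows "0 \<le> poisson_density s \<mu>" "poisson_density s \<mu> \<le> 1"
proof -
  show "0 \<le> poisson_density s \<mu>" using assms by (simp add: poisson_density_def split: nat.split)
  show "poisson_density s \<mu> \<le> 1"
  proof (cases s)
    case 0 then show ?thesis by (simp add: poisson_density_def)
  next
    case (Suc i)
    then show ?thesis
      using poisson_lipschitz_tail_bounds[OF assms, of i] poisson_lipschitz_tail_bounds[OF assms, of s]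
        poisson_density_Suc[of i \<mu>] by simp
  qed
qed

lemma has_derivative_poisson_density:
  "(poisson_density (Suc s) has_real_derivative poisson_density s \<mu> - poisson_density (Suc s) \<mu>) (at \<mu>)"
proof (cases s)
  case 0
  have "((\<lambda>\<mu>. exp (- \<mu>)) has_real_derivative - exp (- \<mu>)) (at \<mu>)"
    by (auto intro!: derivative_eq_intros)
  then show ?thesis using 0 by (simp add: poisson_density_def[abs_def])
next
  case (Suc i)
  have "((\<lambda>\<mu>. \<mu> ^ Suc i / fact (Suc i) * exp (- \<mu>)) has_real_derivative
      (of_nat (Suc i) * \<mu> ^ i) / fact (Suc i) * exp (- \<mu>) - \<mu> ^ Suc i / fact (Suc i) * exp (- \<mu>)) (at \<mu>)"
    by (auto intro!: derivative_eq_intros simp del: fact_Suc power_Suc simp: diff_divide_distrib)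
  also have "(of_nat (Suc i) * \<mu> ^ i) / fact (Suc i) = \<mu> ^ i / (fact i :: real)"
    by (simp add: divide_simps del: of_nat_Suc)
  finally show ?thesis using Suc by (simp add: poisson_density_def[abs_def])
qed

lemma has_derivative_poisson_tail:
  "(poisson_tail s has_real_derivative poisson_density s \<mu>) (at \<mu>)"
proof (induction s)
  case 0
  then show ?case by (simp add: poisson_tail_def[abs_def] poisson_density_def)
next
  case (Suc s)
  have "poisson_tail (Suc s) = (\<lambda>\<mu>. poisson_tail s \<mu> - poisson_density (Suc s) \<mu>)"
    by (simp add: poisson_density_Suc fun_eq_iff)
  then show ?case
    using DERIV_diff[OF Suc has_derivative_poisson_density[of s \<mu>]] by simp
qed

section \<open>Lipschitz bounds and Poisson approximation\<close>

lemma poisson_tail_lipschitz: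
  assumes "0 \<le> a" "0 \<le> b"
  shows "\<bar>poisson_tail s a - poisson_tail s b\<bar> \<le> \<bar>a - b\<bar>"
proof -
  have "norm (poisson_tail s a - poisson_tail s b) \<le> 1 * norm (a - b)"
  proof (rule field_differentiable_bound[of "{0..}"])
    show "norm (poisson_density s z) \<le> 1" if "z \<in> {0..}" for z
      using poisson_density_bounds[of z s] that by simp
  qed (use assms in \<open>auto intro: has_field_derivative_at_within has_derivative_poisson_tail\<close>)
  then show ?thesis by simp
qed

lemma poisson_density_lipschitz:
  assumes "0 \<le> a" "0 \<le> b"
  shows "\<bar>poisson_density s a - poisson_density s b\<bar> \<le> \<bar>a - b\<bar>"
proof (cases s)
  case 0 then show ?thesis by (simp add: poisson_density_def)
next
  case (Suc i)
  have "norm (poisson_density (Suc i) a - poisson_density (Suc i) b) \<le> 1 * norm (a - b)"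
  proof (rule field_differentiable_bound[of "{0..}"])
    show "norm (poisson_density i z - poisson_density (Suc i) z) \<le> 1" if "z \<in> {0..}" for z
      using poisson_density_bounds[of z i] poisson_density_bounds[of z "Suc i"] that by simp
  qed (use assms in \<open>auto intro: has_field_derivative_at_within has_derivative_poisson_density\<close>)
  then show ?thesis using Suc by simp
qed

text \<open>Adding a Bernoulli trial to a Poisson variable agrees to first order with raising the
  mean by \<open>p\<close>, because the derivative of the tail is the difference of two consecutive
  tails. The mean value theorem leaves \<open>p\<close> times an increment of the density, which is
  1-Lipschitz.\<close>

lemma poisson_tail_step:
  assumes "0 \<le> \<mu>" "0 \<le> p"
  shows "\<bar>poisson_tail (Suc s) (\<mu> + p) - (p * poisson_tail s \<mu> + (1 - p) * poisson_tail (Suc s) \<mu>)\<bar> \<le> p\<^sup>2"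
proof (cases "p = 0")
  case False
  then have "\<mu> < \<mu> + p" using assms by simp
  from MVT2[OF this, of "poisson_tail (Suc s)" "poisson_density (Suc s)"]
  obtain z where z: "\<mu> < z" "z < \<mu> + p"
    "poisson_tail (Suc s) (\<mu> + p) - poisson_tail (Suc s) \<mu> = p * poisson_density (Suc s) z"
    using has_derivative_poisson_tail by auto
  have "poisson_tail (Suc s) (\<mu> + p) - (p * poisson_tail s \<mu> + (1 - p) * poisson_tail (Suc s) \<mu>)
      = p * (poisson_density (Suc s) z - poisson_density (Suc s) \<mu>)"
    unfolding right_diff_distrib z(3)[symmetric] poisson_density_Suc[of s \<mu>]
    by (simp add: algebra_simps)
  also have "\<bar>\<dots>\<bar> \<le> p * \<bar>z - \<mu>\<bar>"
    unfolding abs_mult using assms z poisson_density_lipschitz[of z \<mu> "Suc s"]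
    by (intro mult_mono) auto
  also have "\<dots> \<le> p * p" using assms z by (intro mult_left_mono) auto
  finally show ?thesis by (simp add: power2_eq_square)
qed (use assms in simp)

text \<open>A bound of Le Cam type. Trials are replaced by Poisson summands one at a time, at cost
  \<open>p^2\<close> each; earlier errors are averaged with weights \<open>p\<close> and
  \<open>1 - p\<close> and hence not amplified.\<close>

lemma binomial_tail_poisson_tail:
  assumes "0 \<le> p" "p \<le> 1"
  shows "\<bar>binomial_tail p s k - poisson_tail s (real k * p)\<bar> \<le> real k * p\<^sup>2"
proof (induction k arbitrary: s)
  case 0
  show ?case
    by (cases s) (simp_all add: poisson_tail_def lessThan_Suc_eq_insert_0 sum.reindex power_0_left)
next
  case (Suc k)
  show ?case
  proof (cases s)
    case 0
    then show ?thesis by (simp add: poisson_tail_def)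
  next
    case (Suc r)
    let ?\<mu> = "real k * p"
    let ?d = "\<lambda>s. binomial_tail p s k - poisson_tail s ?\<mu>"
    let ?e = "poisson_tail (Suc r) (?\<mu> + p) -
      (p * poisson_tail r ?\<mu> + (1 - p) * poisson_tail (Suc r) ?\<mu>)"
    have "binomial_tail p s (Suc k) - poisson_tail s (real (Suc k) * p) =
        p * ?d r + (1 - p) * ?d (Suc r) - ?e"
      by (simp add: Suc algebra_simps)
    then have "\<bar>binomial_tail p s (Suc k) - poisson_tail s (real (Suc k) * p)\<bar> \<le>
        \<bar>p * ?d r\<bar> + \<bar>(1 - p) * ?d (Suc r)\<bar> + \<bar>?e\<bar>" by linarith
    also have "\<dots> \<le> p * (real k * p\<^sup>2) + (1 - p) * (real k * p\<^sup>2) + p\<^sup>2"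
    proof (intro add_mono)
      show "\<bar>p * ?d r\<bar> \<le> p * (real k * p\<^sup>2)"
        unfolding abs_mult using assms Suc.IH[of r] by (intro mult_mono) auto
      show "\<bar>(1 - p) * ?d (Suc r)\<bar> \<le> (1 - p) * (real k * p\<^sup>2)"
        unfolding abs_mult using assms Suc.IH[of "Suc r"] by (intro mult_mono) auto
    qed (use assms poisson_tail_step in auto)
    finally show ?thesis by (simp add: algebra_simps)
  qed
qed


lemma de_x_bounds:
  assumes "0 \<le> c"
  shows "0 \<le> de_x c t j \<and> de_x c t j \<le> 1"
proof (induction j)
  case (Suc j)
  then show ?case using assms poisson_lipschitz_tail_bounds[of "c * de_x c t j" t] by simp
qed simp

text \<open>One step of density evolution with its two errors: the Poisson approximation, and the
  deviation of the fraction \<open>k / n\<close> of senders from \<open>x\<close>.\<close>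

lemma binomial_tail_de:
  assumes "0 \<le> c" "c \<le> real n" "0 < n" "k \<le> n" "0 \<le> x"
  shows "\<bar>binomial_tail (c / real n) s k - poisson_tail s (c * x)\<bar> \<le>
    c\<^sup>2 / real n + c * \<bar>real k / real n - x\<bar>"
proof -
  let ?p = "c / real n"
  have p: "0 \<le> ?p" "?p \<le> 1" using assms by auto
  have "\<bar>binomial_tail ?p s k - poisson_tail s (real k * ?p)\<bar> \<le> real k * ?p\<^sup>2"
    by (rule binomial_tail_poisson_tail[OF p])
  also have "\<dots> \<le> real n * ?p\<^sup>2" using assms by (intro mult_right_mono) auto
  also have "\<dots> = c\<^sup>2 / real n" using assms by (simp add: power2_eq_square)
  finally have 1: "\<bar>binomial_tail ?p s k - poisson_tail s (real k * ?p)\<bar> \<le> c\<^sup>2 / real n" .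
  have "\<bar>poisson_tail s (real k * ?p) - poisson_tail s (c * x)\<bar> \<le> \<bar>real k * ?p - c * x\<bar>"
    using assms by (intro poisson_tail_lipschitz) auto
  also have "real k * ?p - c * x = c * (real k / real n - x)" by (simp add: algebra_simps)
  also have "\<bar>\<dots>\<bar> = c * \<bar>real k / real n - x\<bar>" using assms by (simp add: abs_mult)
  finally show ?thesis using 1 by linarith
qed

subsection \<open>Peeling and its cavity version\<close>

text \<open>Only the earlier survival of the neighbours is asked for; that of \<open>u\<close>
  itself follows by \<open>survive_antimono\<close>.\<close>

primrec survive :: "nat set \<Rightarrow> nat \<Rightarrow> (nat set \<Rightarrow> bool) \<Rightarrow> nat \<Rightarrow> nat \<Rightarrow> bool" where
  "survive V t w 0 u \<longleftrightarrow> True"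
| "survive V t w (Suc j) u \<longleftrightarrow> t < card {x \<in> V - {u}. w {u, x} \<and> survive V t w j x}"

text \<open>
  The message which \<open>u\<close> sends to a deleted neighbour (hence the threshold \<open>t\<close> instead of \<open>t + 1\<close>) in
  the subgraph induced by the set \<open>U\<close> of vertices that are not deleted.
\<close>

primrec cavity :: "nat \<Rightarrow> (nat set \<Rightarrow> bool) \<Rightarrow> nat \<Rightarrow> nat set \<Rightarrow> nat \<Rightarrow> bool" where
  "cavity t w 0 U u \<longleftrightarrow> True"
| "cavity t w (Suc j) U u \<longleftrightarrow> t \<le> card {x \<in> U - {u}. w {u, x} \<and> cavity t w j (U - {u}) x}"

text \<open>
  A self-avoiding path of at most \<open>j\<close> edges which starts in \<open>u\<close>, stays in \<open>U\<close>, and ends in a vertex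
  adjacent to a vertex that is already deleted (in \<open>V - U\<close> or on the path) and not its predecessor.
\<close>

primrec short_cycle :: "nat set \<Rightarrow> (nat set \<Rightarrow> bool) \<Rightarrow> nat \<Rightarrow> nat set \<Rightarrow> nat \<Rightarrow> bool" where
  "short_cycle V w 0 U u \<longleftrightarrow> False"
| "short_cycle V w (Suc j) U u \<longleftrightarrow>
     (\<exists>x\<in>U - {u}. w {u, x} \<and> ((\<exists>a\<in>V - U. w {x, a}) \<or> short_cycle V w j (U - {u}) x))"

lemma survive_antimono:
  assumes "finite V"
  shows "survive V t w (Suc j) u \<Longrightarrow> survive V t w j u"
proof (induction j arbitrary: u)
  case (Suc j)
  have "card {x \<in> V - {u}. w {u, x} \<and> survive V t w (Suc j) x}
      \<le> card {x \<in> V - {u}. w {u, x} \<and> survive V t w j x}"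
  proof (rule card_mono)
    show "{x \<in> V - {u}. w {u, x} \<and> survive V t w (Suc j) x} \<subseteq>
        {x \<in> V - {u}. w {u, x} \<and> survive V t w j x}"
      using Suc.IH by blast
  qed (simp add: assms)
  moreover have "t < card {x \<in> V - {u}. w {u, x} \<and> survive V t w (Suc j) x}"
    using Suc.prems by (simp only: survive.simps)
  ultimately show ?case by simp
qed simp

text \<open>At most one of the more than \<open>t\<close> surviving neighbours is already deleted,
  so at least \<open>t\<close> of them lie in \<open>U\<close>. Without a short cycle the only
  deleted neighbour of a child is \<open>u\<close>, and the assumption is inherited.\<close>

lemma survive_imp_cavity:
  assumes "finite V"
  shows "U \<subseteq> V \<Longrightarrow> u \<in> U \<Longrightarrow> card {a \<in> V - U. w {u, a}} \<le> 1 \<Longrightarrow> \<not> short_cycle V w j U u \<Longrightarrow>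
    survive V t w j u \<Longrightarrow> cavity t w j U u"
proof (induction j arbitrary: U u)
  case (Suc j)
  let ?A = "{a \<in> V - U. w {u, a}}"
  let ?T = "{x \<in> U - {u}. w {u, x} \<and> cavity t w j (U - {u}) x}"
  have fin: "finite U" using Suc.prems assms finite_subset by blast
  have "cavity t w j (U - {u}) x" if x: "x \<in> U - {u}" "w {u, x}" "survive V t w j x" for x
  proof (rule Suc.IH)
    have nc: "\<not> w {x, a}" if "a \<in> V - U" for a using Suc.prems(4) x that by auto
    have "{a \<in> V - (U - {u}). w {x, a}} \<subseteq> {u}" using nc by auto
    then have "card {a \<in> V - (U - {u}). w {x, a}} \<le> card {u}" by (intro card_mono) auto
    then show "card {a \<in> V - (U - {u}). w {x, a}} \<le> 1" by simp
  qed (use Suc.prems x in auto)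
  then have "{x \<in> V - {u}. w {u, x} \<and> survive V t w j x} \<subseteq> ?A \<union> ?T" by auto
  then have "card {x \<in> V - {u}. w {u, x} \<and> survive V t w j x} \<le> card (?A \<union> ?T)"
    using assms fin by (intro card_mono) auto
  also have "\<dots> \<le> card ?A + card ?T" by (rule card_Un_le)
  finally have "t < 1 + card ?T" using Suc.prems by simp
  then show ?case by simp
qed simp

text \<open>The deleted but surviving neighbour \<open>a\<close> supplies the one message that is
  missing to get from \<open>t\<close> to \<open>t + 1\<close>. For the children of \<open>u\<close>
  this role is played by \<open>u\<close>, whose survival for fewer rounds must be known first;
  hence the complete induction on \<open>i\<close>, which is decoupled from the depth
  \<open>j\<close>.\<close>

lemma cavity_imp_survive:
  assumes "finite V"
  shows "U \<subseteq> V \<Longrightarrow> u \<in> U \<Longrightarrow> a \<in> V - U \<Longrightarrow> w {u, a} \<Longrightarrow> i \<le> j \<Longrightarrow>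
    (\<And>k. k < i \<Longrightarrow> survive V t w k a) \<Longrightarrow> cavity t w j U u \<Longrightarrow> survive V t w i u"
proof (induction i arbitrary: U u a j rule: less_induct)
  case (less i)
  show ?case
  proof (cases i)
    case (Suc i')
    then obtain j' where j: "j = Suc j'" "i' \<le> j'" using less.prems(5) by (cases j) auto
    let ?T = "{x \<in> U - {u}. w {u, x} \<and> cavity t w j' (U - {u}) x}"
    have fin: "finite U" using less.prems assms finite_subset by blast
    have u: "survive V t w k u" if "k < i'" for k
      by (rule less.IH[of k U u a j]) (use less.prems that Suc in auto)
    have "survive V t w i' x" if x: "x \<in> ?T" for x
      by (rule less.IH[of i' "U - {u}" x u j'])
        (use less.prems x Suc u j in \<open>auto simp: insert_commute\<close>)
    then have "insert a ?T \<subseteq> {x \<in> V - {u}. w {u, x} \<and> survive V t w i' x}"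
      using less.prems Suc by auto
    then have "card (insert a ?T) \<le> card {x \<in> V - {u}. w {u, x} \<and> survive V t w i' x}"
      using assms by (intro card_mono) auto
    moreover have "card (insert a ?T) = Suc (card ?T)"
      using less.prems(3) fin by (intro card_insert_disjoint) auto
    ultimately show ?thesis using less.prems(7) j Suc by simp
  qed simp
qed

text \<open>The root has no deleted neighbour to make up for, so it keeps the full threshold
  \<open>t + 1\<close>. This is the difference between \<open>de_z\<close> and
  \<open>de_x\<close>.\<close>

definition root_cavity :: "nat set \<Rightarrow> nat \<Rightarrow> (nat set \<Rightarrow> bool) \<Rightarrow> nat \<Rightarrow> nat \<Rightarrow> bool" where
  "root_cavity V t w j v \<longleftrightarrow> Suc t \<le> card {x \<in> V - {v}. w {v, x} \<and> cavity t w j (V - {v}) x}"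

lemma survive_imp_root_cavity:
  assumes "finite V" "v \<in> V" "\<not> short_cycle V w (Suc j) V v" "survive V t w (Suc j) v"
  shows "root_cavity V t w j v"
proof -
  have "cavity t w j (V - {v}) x" if x: "x \<in> V - {v}" "w {v, x}" "survive V t w j x" for x
  proof (rule survive_imp_cavity[OF assms(1)])
    have "{a \<in> V - (V - {v}). w {x, a}} \<subseteq> {v}" by auto
    then have "card {a \<in> V - (V - {v}). w {x, a}} \<le> card {v}" by (intro card_mono) auto
    then show "card {a \<in> V - (V - {v}). w {x, a}} \<le> 1" by simp
  qed (use assms x in auto)
  then have "card {x \<in> V - {v}. w {v, x} \<and> survive V t w j x}
      \<le> card {x \<in> V - {v}. w {v, x} \<and> cavity t w j (V - {v}) x}"
    using assms(1) by (intro card_mono) auto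
  then show ?thesis using assms(4) by (simp add: root_cavity_def)
qed

text \<open>The survival of \<open>v\<close> in earlier rounds is what its neighbours need in order
  to survive themselves, so all \<open>i\<close> up to \<open>j + 1\<close> are treated
  together.\<close>

lemma root_cavity_imp_survive:
  assumes "finite V" "v \<in> V" "root_cavity V t w j v"
  shows "i \<le> Suc j \<Longrightarrow> survive V t w i v"
proof (induction i rule: less_induct)
  case (less i)
  show ?case
  proof (cases i)
    case (Suc i')
    have "survive V t w i' x"
      if x: "x \<in> V - {v}" "w {v, x}" "cavity t w j (V - {v}) x" for x
      by (rule cavity_imp_survive[OF assms(1), of "V - {v}" x v w i' j])
        (use assms x less Suc in \<open>auto simp: insert_commute\<close>)
    then have "card {x \<in> V - {v}. w {v, x} \<and> cavity t w j (V - {v}) x}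
        \<le> card {x \<in> V - {v}. w {v, x} \<and> survive V t w i' x}"
      using assms(1) by (intro card_mono) auto
    then show ?thesis using assms(3) Suc by (simp add: root_cavity_def)
  qed simp
qed

lemma survive_root_cavity_discrepancy:
  assumes "finite V" "v \<in> V"
  shows "\<bar>of_bool (survive V t w (Suc j) v) - of_bool (root_cavity V t w j v)\<bar>
    \<le> (of_bool (short_cycle V w (Suc j) V v) :: real)"
  using survive_imp_root_cavity[OF assms, of w j t] root_cavity_imp_survive[OF assms, of t w j "Suc j"]
  by (auto simp del: survive.simps short_cycle.simps)

lemma peel_iterate:
  fixes w :: "nat set \<Rightarrow> bool"
  defines "V n \<equiv> component_codes n"
  shows "(peel t ^^ l) (residual_graph n w) =
    ({v \<in> V n. survive (V n) t w l v}, {e \<in> code_bits n. w e \<and> (\<forall>v\<in>e. survive (V n) t w l v)})"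
proof (induction l)
  case 0
  show ?case by (simp add: residual_graph_def V_def)
next
  case (Suc l)
  let ?S = "survive (V n) t w"
  let ?E = "{e \<in> code_bits n. w e \<and> (\<forall>v\<in>e. ?S l v)}"
  have fin: "finite (V n)" by (simp add: V_def component_codes_def)
  \<comment> \<open>The current degree of a surviving vertex is its number of surviving neighbours,
    which turns peeling into the local recursion.\<close>
  have deg: "vertex_degree ?E v = card {x \<in> V n - {v}. w {v, x} \<and> ?S l x}"
    if v: "v \<in> V n" "?S l v" for v
  proof -
    have "{e \<in> ?E. v \<in> e} = (\<lambda>x. {v, x}) ` {x \<in> V n - {v}. w {v, x} \<and> ?S l x}"
    proof (intro equalityI subsetI)
      fix e assume e: "e \<in> {e \<in> ?E. v \<in> e}"
      then obtain x where "e = {v, x}" "x \<noteq> v"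
        by (auto simp: code_bits_def card_2_iff)
      then show "e \<in> (\<lambda>x. {v, x}) ` {x \<in> V n - {v}. w {v, x} \<and> ?S l x}"
        using e by (auto simp: code_bits_def V_def)
    qed (use v in \<open>auto simp: code_bits_def V_def\<close>)
    moreover have "inj_on (\<lambda>x. {v, x}) X" for X by (auto simp: inj_on_def doubleton_eq_iff)
    ultimately show ?thesis unfolding vertex_degree_def by (simp add: card_image)
  qed
  have R: "{v \<in> {v \<in> V n. ?S l v}. vertex_degree ?E v \<le> t} =
      {v \<in> V n. ?S l v \<and> \<not> ?S (Suc l) v}"
    by (auto simp: deg)
  have mono: "?S (Suc l) v \<Longrightarrow> ?S l v" for v by (rule survive_antimono[OF fin])
  have sub: "e \<subseteq> V n" if "e \<in> code_bits n" for e using that by (simp add: code_bits_def V_def)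
  have "(peel t ^^ Suc l) (residual_graph n w) = peel t ({v \<in> V n. ?S l v}, ?E)"
    using Suc by simp
  also have "\<dots> = ({v \<in> V n. ?S (Suc l) v}, {e \<in> code_bits n. w e \<and> (\<forall>v\<in>e. ?S (Suc l) v)})"
  proof -
    have "{e \<in> ?E. e \<inter> {v \<in> V n. ?S l v \<and> \<not> ?S (Suc l) v} = {}} =
        {e \<in> code_bits n. w e \<and> (\<forall>v\<in>e. ?S (Suc l) v)}"
      using mono sub by blast
    moreover have "{v \<in> V n. ?S l v} - {v \<in> V n. ?S l v \<and> \<not> ?S (Suc l) v} = {v \<in> V n. ?S (Suc l) v}"
      using mono by blast
    ultimately show ?thesis unfolding peel_pair R by simp
  qed
  finally show ?case .
qed

lemma failed_fraction_survive:
  "failed_fraction n t l w = real (card {v \<in> {1..n}. survive {1..n} t w l v}) / real n"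
proof -
  have "failed_fraction n t l w = (\<Sum>v\<in>{1..n}. of_bool (survive {1..n} t w l v)) / real n"
    by (simp add: failed_fraction_def component_failure_def peel_iterate component_codes_def)
  then show ?thesis by (simp add: Int_def)
qed

text \<open>Union bound: deleting \<open>z\<close> alters the message of \<open>u\<close> only if
  \<open>z\<close> is a neighbour of \<open>u\<close> or the message from some other neighbour is
  altered. The indicators are written as products so that expectations factor.\<close>

lemma cavity_discrepancy:
  assumes "finite U"
  shows "of_bool (cavity t w (Suc j) U u \<noteq> cavity t w (Suc j) (U - {z}) u) \<le>
    of_bool (w {u, z}) + (\<Sum>x\<in>U - {u, z}. of_bool (w {u, x}) *
      of_bool (cavity t w j (U - {u}) x \<noteq> cavity t w j (U - {u} - {z}) x) :: real)" (is "?L \<le> ?a + ?s")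
proof (cases "?L = 0")
  case True
  then show ?thesis by (simp only:) (intro add_nonneg_nonneg sum_nonneg, auto)
next
  case False
  then have ne: "cavity t w (Suc j) U u \<noteq> cavity t w (Suc j) (U - {z}) u" by auto
  have L: "?L \<le> 1" by simp
  show ?thesis
  proof (cases "w {u, z}")
    case True
    have "0 \<le> ?s" by (intro sum_nonneg) auto
    then show ?thesis using True L by simp
  next
    case notw: False
    have "\<exists>x\<in>U - {u, z}. w {u, x} \<and> cavity t w j (U - {u}) x \<noteq> cavity t w j (U - {u} - {z}) x"
    proof (rule ccontr)
      assume "\<not> ?thesis"
      moreover have "U - {z} - {u} = U - {u} - {z}" by auto
      ultimately have "{x \<in> U - {u}. w {u, x} \<and> cavity t w j (U - {u}) x} =
          {x \<in> U - {z} - {u}. w {u, x} \<and> cavity t w j (U - {z} - {u}) x}"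
        using notw by auto
      then show False using ne by simp
    qed
    then obtain x where x: "x \<in> U - {u, z}" "w {u, x}"
      "cavity t w j (U - {u}) x \<noteq> cavity t w j (U - {u} - {z}) x" by blast
    have "1 \<le> ?s" using x assms by (intro order.trans[OF _ member_le_sum[OF x(1)]]) auto
    moreover have "0 \<le> ?a" by simp
    ultimately show ?thesis using L by linarith
  qed
qed

text \<open>Union bound over the first edge of the path and over the edge that closes the
  cycle.\<close>

lemma short_cycle_le:
  assumes "finite V" "U \<subseteq> V"
  shows "of_bool (short_cycle V w (Suc j) U u) \<le>
    (\<Sum>x\<in>U - {u}. (\<Sum>a\<in>V - U. of_bool (w {u, x}) * of_bool (w {x, a})) +
      of_bool (w {u, x}) * of_bool (short_cycle V w j (U - {u}) x) :: real)" (is "?L \<le> sum ?g _")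
proof (cases "short_cycle V w (Suc j) U u")
  case True
  then obtain x where x: "x \<in> U - {u}" "w {u, x}"
    "(\<exists>a\<in>V - U. w {x, a}) \<or> short_cycle V w j (U - {u}) x" by auto
  have fin: "finite (U - {u})" "finite (V - U)" using assms finite_subset by auto
  have nonneg: "0 \<le> ?g y" for y by (intro add_nonneg_nonneg sum_nonneg) auto
  have "1 \<le> ?g x"
  proof (cases "short_cycle V w j (U - {u}) x")
    case True
    then show ?thesis using x by (simp add: sum_nonneg)
  next
    case False
    then obtain a where a: "a \<in> V - U" "w {x, a}" using x by auto
    have "of_bool (w {u, x}) * of_bool (w {x, a}) \<le>
        (\<Sum>a\<in>V - U. of_bool (w {u, x}) * of_bool (w {x, a}) :: real)"
      by (rule member_le_sum[OF a(1)]) (use fin in auto)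
    then have "1 \<le> (\<Sum>a\<in>V - U. of_bool (w {u, x}) * of_bool (w {x, a}) :: real)"
      using a x by simp
    then show ?thesis by (intro add_increasing2) simp_all
  qed
  also have "?g x \<le> sum ?g (U - {u})" by (rule member_le_sum[OF x(1) nonneg fin(1)])
  finally show ?thesis using True by simp
next
  case False
  then show ?thesis by (simp only: of_bool_eq) (intro sum_nonneg add_nonneg_nonneg, auto)
qed

text \<open>A vertex can differ in round \<open>j + 1\<close> only if it lies in \<open>X\<close>,
  is adjacent to \<open>X\<close> in one of the two graphs, or is adjacent to a vertex that differs
  in round \<open>j\<close>. So the number of differing vertices grows by a factor \<open>D\<close>
  per round, plus \<open>card X * (1 + 2 * D)\<close>.\<close>

lemma survive_difference:
  assumes "finite V" "finite X"
    and agree: "\<And>x y. x \<notin> X \<Longrightarrow> y \<notin> X \<Longrightarrow> w {x, y} = w' {x, y}"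
    and deg: "\<And>x. card {y \<in> V - {x}. w {x, y}} \<le> D" "\<And>x. card {y \<in> V - {x}. w' {x, y}} \<le> D"
  shows "card {v \<in> V. survive V t w j v \<noteq> survive V t w' j v} \<le> card X * (1 + 2 * D) * (1 + D) ^ j"
proof (induction j)
  case (Suc j)
  let ?N = "\<lambda>w x. {y \<in> V - {x}. w {x, y}}"
  let ?d = "\<lambda>j. {v \<in> V. survive V t w j v \<noteq> survive V t w' j v}"
  let ?R = "X \<union> (\<Union>x\<in>X. ?N w x \<union> ?N w' x) \<union> (\<Union>x\<in>?d j. ?N w x)"
  have "?d (Suc j) \<subseteq> ?R"
  proof
    fix v assume v: "v \<in> ?d (Suc j)"
    show "v \<in> ?R"
    proof (rule ccontr)
      assume nR: "v \<notin> ?R"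
      have "{x \<in> V - {v}. w {v, x} \<and> survive V t w j x} =
          {x \<in> V - {v}. w' {v, x} \<and> survive V t w' j x}"
      proof (rule Collect_cong, rule conj_cong[OF refl])
        fix x assume x: "x \<in> V - {v}"
        have vV: "v \<in> V" "v \<notin> X" using v nR by auto
        show "(w {v, x} \<and> survive V t w j x) = (w' {v, x} \<and> survive V t w' j x)"
        proof (cases "x \<in> X")
          case True
          then have "\<not> w {x, v}" "\<not> w' {x, v}" using nR vV x by auto
          then show ?thesis by (simp add: insert_commute)
        next
          case False
          then have "w {v, x} = w' {v, x}" using agree vV by blast
          moreover have "survive V t w j x = survive V t w' j x" if "w {v, x}"
            using nR vV x that by (auto simp: insert_commute)
          ultimately show ?thesis by auto
        qed
      qed
      then show False using v by simp
    qed
  qed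
  moreover have "finite ?R" using assms(1,2) by auto
  ultimately have "card (?d (Suc j)) \<le> card ?R" by (rule card_mono[rotated])
  also have "\<dots> \<le> card X + card (\<Union>x\<in>X. ?N w x \<union> ?N w' x) + card (\<Union>x\<in>?d j. ?N w x)"
    by (meson add_mono card_Un_le le_refl order.trans)
  also have "\<dots> \<le> card X + card X * (2 * D) + card (?d j) * D"
  proof (intro add_mono le_refl)
    have "card (?N w x \<union> ?N w' x) \<le> 2 * D" for x
      using card_Un_le[of "?N w x" "?N w' x"] deg(1)[of x] deg(2)[of x] by linarith
    then have "(\<Sum>x\<in>X. card (?N w x \<union> ?N w' x)) \<le> card X * (2 * D)"
      using sum_bounded_above[of X "\<lambda>x. card (?N w x \<union> ?N w' x)" "2 * D"] by simp
    then show "card (\<Union>x\<in>X. ?N w x \<union> ?N w' x) \<le> card X * (2 * D)"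
      using card_UN_le[OF assms(2), of "\<lambda>x. ?N w x \<union> ?N w' x"] by linarith
    have "(\<Sum>x\<in>?d j. card (?N w x)) \<le> card (?d j) * D"
      using sum_bounded_above[of "?d j" "\<lambda>x. card (?N w x)" D] deg(1) by simp
    then show "card (\<Union>x\<in>?d j. ?N w x) \<le> card (?d j) * D"
      using card_UN_le[of "?d j" "\<lambda>x. ?N w x"] assms(1) by fastforce
  qed
  also have "card X + card X * (2 * D) = card X * (1 + 2 * D) * 1" by (simp add: distrib_left)
  also have "\<dots> + card (?d j) * D \<le> card X * (1 + 2 * D) * 1 + card X * (1 + 2 * D) * (1 + D) ^ j * D"
    using Suc by (intro add_mono mult_right_mono) simp_all
  also have "\<dots> \<le> card X * (1 + 2 * D) * (1 + D) ^ j + card X * (1 + 2 * D) * (1 + D) ^ j * D"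
    by (intro add_mono mult_left_mono) simp_all
  also have "\<dots> = card X * (1 + 2 * D) * (1 + D) ^ Suc j" by (simp add: algebra_simps)
  finally show ?case .
qed simp

subsection \<open>Density evolution\<close>

lemma depends_on_cavity:
  "u \<in> U \<Longrightarrow> depends_on (\<lambda>w. cavity t w j U u) {e. e \<subseteq> U}"
proof (induction j arbitrary: U u)
  case 0 then show ?case by (simp add: depends_on_def)
next
  case (Suc j)
  show ?case
  proof (rule depends_onI)
    fix w w' :: "nat set \<Rightarrow> bool" assume eq: "\<And>e. e \<in> {e. e \<subseteq> U} \<Longrightarrow> w e = w' e"
    have "cavity t w j (U - {u}) x = cavity t w' j (U - {u}) x" if "x \<in> U - {u}" for x
      by (rule depends_onD[OF Suc.IH[OF that]]) (use eq in auto)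
    then have "{x \<in> U - {u}. w {u, x} \<and> cavity t w j (U - {u}) x} =
        {x \<in> U - {u}. w' {u, x} \<and> cavity t w' j (U - {u}) x}"
      using eq Suc.prems by auto
    then show "cavity t w (Suc j) U u = cavity t w' (Suc j) U u" by simp
  qed
qed

text \<open>The edges from \<open>u\<close> to deleted vertices are not inspected, in particular not
  the edge along which \<open>u\<close> was reached. Therefore the probability of that edge factors
  out in \<open>expect_short_cycle\<close>.\<close>

lemma depends_on_short_cycle:
  "U \<subseteq> V \<Longrightarrow> u \<in> U \<Longrightarrow> depends_on (\<lambda>w. short_cycle V w j U u) {e. \<not> e \<subseteq> insert u (V - U)}"
proof (induction j arbitrary: U u)
  case 0 then show ?case by (simp add: depends_on_def)
next
  case (Suc j)
  show ?case
  proof (rule depends_onI)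
    fix w w' :: "nat set \<Rightarrow> bool"
    assume eq: "\<And>e. e \<in> {e. \<not> e \<subseteq> insert u (V - U)} \<Longrightarrow> w e = w' e"
    have 1: "w {u, x} = w' {u, x}" "\<And>a. w {x, a} = w' {x, a}" if "x \<in> U - {u}" for x
      by (rule eq, use that in force)+
    have 2: "short_cycle V w j (U - {u}) x = short_cycle V w' j (U - {u}) x" if "x \<in> U - {u}" for x
    proof (rule depends_onD[OF Suc.IH[of "U - {u}" x]])
      fix e assume "e \<in> {e. \<not> e \<subseteq> insert x (V - (U - {u}))}"
      moreover have "insert u (V - U) \<subseteq> insert x (V - (U - {u}))" using Suc.prems by auto
      ultimately show "w e = w' e" by (intro eq) auto
    qed (use Suc.prems that in auto)
    show "short_cycle V w (Suc j) U u = short_cycle V w' (Suc j) U u"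
      using 1 2 by simp
  qed
qed

text \<open>The constants here and below are bounds after multiplication by \<open>n\<close>. The
  parameter \<open>r\<close> is the number of deleted vertices, which grows by one per step of a
  path and by two when a pair is deleted.\<close>

primrec discrepancy_bound :: "real \<Rightarrow> nat \<Rightarrow> real" where
  "discrepancy_bound c 0 = 0"
| "discrepancy_bound c (Suc j) = c + c * discrepancy_bound c j"

primrec cycle_bound :: "real \<Rightarrow> nat \<Rightarrow> nat \<Rightarrow> real" where
  "cycle_bound c 0 r = 0"
| "cycle_bound c (Suc j) r = c\<^sup>2 * real r + c * cycle_bound c j (Suc r)"

primrec mse_bound :: "real \<Rightarrow> nat \<Rightarrow> nat \<Rightarrow> real" where
  "mse_bound c 0 r = (real r)\<^sup>2"
| "mse_bound c (Suc j) r = 1 + 2 * real r + (2 * discrepancy_bound c (Suc j) + 2 * c ^ 4 +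
     2 * c\<^sup>2 * mse_bound c j (r + 2))"

lemma finite_code_bits [simp]: "finite (code_bits n)"
  by (rule finite_subset[of _ "Pow {1..n}"]) (auto simp: code_bits_def component_codes_def)

lemma card_code_bits: "card (code_bits n) = n choose 2"
  using n_subsets[of "{1..n}" 2] by (simp add: code_bits_def component_codes_def)

lemma power2_add_le: "(a + b)\<^sup>2 \<le> 2 * a\<^sup>2 + 2 * b\<^sup>2" for a b :: real
  using zero_le_power2[of "a - b"] by (simp add: power2_eq_square algebra_simps)

text \<open>Exchanging one indicator changes the product by at most one, as the other factor lies in
  \<open>[-1, 1]\<close>.\<close>

lemma of_bool_diff_mult_le:
  fixes x :: real
  assumes "0 \<le> x" "x \<le> 1"
  shows "(of_bool P - x) * (of_bool Q - x) \<le>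
    (of_bool P' - x) * (of_bool Q' - x) + of_bool (P \<noteq> P') + of_bool (Q \<noteq> Q')"
proof -
  have "0 \<le> x * x" "x * x \<le> x" using assms by (auto intro: mult_left_le)
  then show ?thesis using assms by (cases P; cases Q; cases P'; cases Q') (auto simp: algebra_simps)
qed

text \<open>The bound \<open>c \<le> real n\<close> makes \<open>p\<close> a genuine probability,
  which \<open>bernoulli_pmf\<close> does not clip.\<close>

locale sparse_graph =
  fixes n :: nat and c :: real
  assumes c_pos: "0 < c" and c_le: "c \<le> real n"
begin

abbreviation "V \<equiv> {1..n}"
abbreviation "p \<equiv> c / real n"
abbreviation "E f \<equiv> expect (code_bits n) p f"

lemma n_pos: "0 < n" using c_pos c_le by (cases n) auto

lemma p_bounds: "0 \<le> p" "p \<le> 1" using c_pos c_le n_pos by auto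

lemma n_mult_p: "real n * p = c" using n_pos by simp

lemma edge_in: "u \<in> V \<Longrightarrow> x \<in> V \<Longrightarrow> u \<noteq> x \<Longrightarrow> {u, x} \<in> code_bits n"
  by (simp add: code_bits_def component_codes_def)

lemma expect_edge: "u \<in> V \<Longrightarrow> x \<in> V \<Longrightarrow> u \<noteq> x \<Longrightarrow> E (\<lambda>w. of_bool (w {u, x})) = p"
  by (intro expect_coordinate finite_code_bits edge_in p_bounds)

lemma depends_on_edge: "depends_on (\<lambda>w. of_bool (w e) :: real) {e}"
  by (auto intro: depends_onI)

lemma expect_edge_mult:
  assumes "u \<in> V" "x \<in> V" "u \<noteq> x" "depends_on f B" "{u, x} \<notin> B"
  shows "E (\<lambda>w. of_bool (w {u, x}) * f w) = p * E f"
  using expect_indep[OF finite_code_bits depends_on_edge assms(4)] assms expect_edge by simp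

lemma expect_star:
  assumes "u \<in> V" "Y \<subseteq> V - {u}"
  shows "E (\<lambda>w. of_bool (s \<le> card {x \<in> Y. w {u, x}})) = binomial_tail p s (card Y)"
proof (rule expect_count_ge)
  show "finite Y" using assms finite_subset by blast
  show "inj_on (\<lambda>x. {u, x}) Y" by (auto simp: inj_on_def doubleton_eq_iff)
  show "(\<lambda>x. {u, x}) ` Y \<subseteq> code_bits n" using assms by (auto intro!: edge_in)
qed (use p_bounds in auto)

lemma depends_on_star:
  fixes u :: nat
  shows "depends_on (\<lambda>w. of_bool (s \<le> card {x \<in> Y. w {u, x}}) :: real) {{u, x} | x. x \<in> Y}"
proof (rule depends_onI)
  fix w w' :: "nat set \<Rightarrow> bool" assume "\<And>e. e \<in> {{u, x} | x. x \<in> Y} \<Longrightarrow> w e = w' e"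
  then have "{x \<in> Y. w {u, x}} = {x \<in> Y. w' {u, x}}" by blast
  then show "of_bool (s \<le> card {x \<in> Y. w {u, x}}) = (of_bool (s \<le> card {x \<in> Y. w' {u, x}}) :: real)"
    by simp
qed

text \<open>An edge at \<open>u\<close> is independent of messages computed without
  \<open>u\<close>, so each level contributes a factor \<open>n * p = c\<close>, and an edge to the
  particular vertex \<open>z\<close> has probability only \<open>c / n\<close>.\<close>

lemma expect_cavity_discrepancy:
  "U \<subseteq> V \<Longrightarrow> u \<in> U \<Longrightarrow> z \<in> U \<Longrightarrow> z \<noteq> u \<Longrightarrow>
    E (\<lambda>w. of_bool (cavity t w j U u \<noteq> cavity t w j (U - {z}) u)) \<le> discrepancy_bound c j / real n"
proof (induction j arbitrary: U u)
  case (Suc j)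
  have fin: "finite U" using Suc.prems finite_subset by blast
  let ?d = "\<lambda>x w. of_bool (cavity t w j (U - {u}) x \<noteq> cavity t w j (U - {u} - {z}) x) :: real"
  have "E (\<lambda>w. of_bool (cavity t w (Suc j) U u \<noteq> cavity t w (Suc j) (U - {z}) u)) \<le>
      E (\<lambda>w. of_bool (w {u, z}) + (\<Sum>x\<in>U - {u, z}. of_bool (w {u, x}) * ?d x w))"
    by (intro expect_mono finite_code_bits cavity_discrepancy fin)
  also have "\<dots> = E (\<lambda>w. of_bool (w {u, z})) + E (\<lambda>w. \<Sum>x\<in>U - {u, z}. of_bool (w {u, x}) * ?d x w)"
    by (intro Bochner_Integration.integral_add integrable_bern finite_code_bits)
  also have "E (\<lambda>w. of_bool (w {u, z})) = p"
    using Suc.prems by (intro expect_edge) auto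
  also have "E (\<lambda>w. \<Sum>x\<in>U - {u, z}. of_bool (w {u, x}) * ?d x w) =
      (\<Sum>x\<in>U - {u, z}. E (\<lambda>w. of_bool (w {u, x}) * ?d x w))"
    by (rule expect_sum) simp
  also have "\<dots> \<le> (\<Sum>x\<in>U - {u, z}. p * (discrepancy_bound c j / real n))"
  proof (rule sum_mono)
    fix x assume x: "x \<in> U - {u, z}"
    have "depends_on (?d x) {e. e \<subseteq> U - {u}}"
      using x by (intro depends_on_comp2[where h = "\<lambda>a b. of_bool (a \<noteq> b)"]
          depends_on_cavity depends_on_mono[OF depends_on_cavity[of x "U - {u} - {z}"]]) auto
    then have "E (\<lambda>w. of_bool (w {u, x}) * ?d x w) = p * E (?d x)"
      using x Suc.prems by (intro expect_edge_mult) auto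
    also have "\<dots> \<le> p * (discrepancy_bound c j / real n)"
      using x Suc.prems p_bounds by (intro mult_left_mono Suc.IH) auto
    finally show "E (\<lambda>w. of_bool (w {u, x}) * ?d x w) \<le> p * (discrepancy_bound c j / real n)" .
  qed
  also have "\<dots> \<le> real n * (p * (discrepancy_bound c j / real n))"
  proof -
    have "card (U - {u, z}) \<le> card V" using Suc.prems(1) by (intro card_mono) auto
    moreover have "0 \<le> discrepancy_bound c k" for k by (induction k) (use c_pos in auto)
    ultimately show ?thesis using p_bounds by (simp add: mult_right_mono del: times_divide_eq_right times_divide_eq_left)
  qed
  also have "p + \<dots> = discrepancy_bound c (Suc j) / real n"
    using n_pos by (simp add: field_simps)
  finally show ?case by simp
qed simp

lemma cycle_bound_nonneg: "0 \<le> cycle_bound c j r"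
  by (induction j arbitrary: r) (use c_pos in auto)

text \<open>Extending the path costs a factor \<open>n * p = c\<close>, but closing it at one of
  \<open>r\<close> deleted vertices has probability at most \<open>r * p\<close>, which gives the
  order \<open>1 / n\<close>.\<close>

lemma expect_short_cycle:
  "U \<subseteq> V \<Longrightarrow> u \<in> U \<Longrightarrow> card (V - U) = r \<Longrightarrow>
    E (\<lambda>w. of_bool (short_cycle V w j U u)) \<le> cycle_bound c j r / real n"
proof (induction j arbitrary: U u r)
  case (Suc j)
  have fin: "finite U" using Suc.prems finite_subset by blast
  let ?d = "\<lambda>x w. of_bool (short_cycle V w j (U - {u}) x) :: real"
  let ?K = "real r * p\<^sup>2 + p * (cycle_bound c j (Suc r) / real n)"
  have "E (\<lambda>w. of_bool (short_cycle V w (Suc j) U u)) \<le>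
      E (\<lambda>w. \<Sum>x\<in>U - {u}. (\<Sum>a\<in>V - U. of_bool (w {u, x}) * of_bool (w {x, a})) +
        of_bool (w {u, x}) * ?d x w)"
    using Suc.prems by (intro expect_mono finite_code_bits short_cycle_le) auto
  also have "\<dots> = (\<Sum>x\<in>U - {u}. E (\<lambda>w. (\<Sum>a\<in>V - U. of_bool (w {u, x}) * of_bool (w {x, a})) +
        of_bool (w {u, x}) * ?d x w))"
    by (rule expect_sum) simp
  also have "\<dots> \<le> (\<Sum>x\<in>U - {u}. ?K)"
  proof (rule sum_mono)
    fix x assume x: "x \<in> U - {u}"
    have "E (\<lambda>w. (\<Sum>a\<in>V - U. of_bool (w {u, x}) * of_bool (w {x, a})) + of_bool (w {u, x}) * ?d x w) =
      E (\<lambda>w. \<Sum>a\<in>V - U. of_bool (w {u, x}) * of_bool (w {x, a})) + E (\<lambda>w. of_bool (w {u, x}) * ?d x w)"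
      by (intro Bochner_Integration.integral_add integrable_bern finite_code_bits)
    also have "E (\<lambda>w. \<Sum>a\<in>V - U. of_bool (w {u, x}) * of_bool (w {x, a})) =
      (\<Sum>a\<in>V - U. E (\<lambda>w. of_bool (w {u, x}) * of_bool (w {x, a})))"
      by (rule expect_sum) simp
    also have "\<dots> = (\<Sum>a\<in>V - U. p\<^sup>2)"
    proof (rule sum.cong)
      fix a assume a: "a \<in> V - U"
      have "E (\<lambda>w. of_bool (w {u, x}) * of_bool (w {x, a})) = p * E (\<lambda>w. of_bool (w {x, a}))"
        using a x Suc.prems by (intro expect_edge_mult[OF _ _ _ depends_on_edge])
          (auto simp: doubleton_eq_iff)
      also have "E (\<lambda>w. of_bool (w {x, a})) = p"
        using a x Suc.prems by (intro expect_edge) auto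
      finally show "E (\<lambda>w. of_bool (w {u, x}) * of_bool (w {x, a})) = p\<^sup>2"
        by (simp only: power2_eq_square)
    qed simp
    also have "\<dots> = real r * p\<^sup>2" using Suc.prems by simp
    also have "E (\<lambda>w. of_bool (w {u, x}) * ?d x w) = p * E (?d x)"
      using x Suc.prems by (intro expect_edge_mult[OF _ _ _ depends_on_comp[OF
            depends_on_short_cycle[of "U - {u}" V x]]]) auto
    also have "\<dots> \<le> p * (cycle_bound c j (Suc r) / real n)"
    proof (intro mult_left_mono Suc.IH)
      have "V - (U - {u}) = insert u (V - U)" using Suc.prems by auto
      then show "card (V - (U - {u})) = Suc r" using Suc.prems by simp
    qed (use x Suc.prems p_bounds in auto)
    finally show "E (\<lambda>w. (\<Sum>a\<in>V - U. of_bool (w {u, x}) * of_bool (w {x, a})) +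
      of_bool (w {u, x}) * ?d x w) \<le> ?K" by simp
  qed
  also have "\<dots> \<le> real n * ?K"
  proof -
    have "card (U - {u}) \<le> card V" using Suc.prems(1) by (intro card_mono) auto
    then have "real (card (U - {u})) * ?K \<le> real n * ?K"
      using p_bounds cycle_bound_nonneg[of j "Suc r"] by (intro mult_right_mono add_nonneg_nonneg mult_nonneg_nonneg) auto
    then show ?thesis by simp
  qed
  also have "\<dots> = cycle_bound c (Suc j) r / real n"
    using n_pos by (simp add: field_simps power2_eq_square)
  finally show ?case .
qed simp

text \<open>The core of the second moment bound. First \<open>u\<close> and \<open>v\<close> are
  made to ignore each other, at the cost of \<open>discrepancy_bound\<close>; then both count edges
  into the same set \<open>Y\<close> of senders in \<open>U - {u, v}\<close>. Given
  \<open>Y\<close>, the two counts are independent with the same law, so cross terms become a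
  square, to which the hypothesis for \<open>j\<close> applies.\<close>

lemma expect_pair_deviation:
  assumes U: "U \<subseteq> V" "card (V - U) = r" and uv: "u \<in> U" "v \<in> U" "u \<noteq> v"
    and IH: "\<And>G. G \<subseteq> V \<Longrightarrow> card (V - G) = r + 2 \<Longrightarrow>
      E (\<lambda>w. (real (card {x \<in> G. cavity t w j G x}) / real n - de_x c t j)\<^sup>2)
        \<le> mse_bound c j (r + 2) / real n"
  shows "E (\<lambda>w. (of_bool (cavity t w (Suc j) U u) - de_x c t (Suc j)) *
      (of_bool (cavity t w (Suc j) U v) - de_x c t (Suc j))) \<le>
    (2 * discrepancy_bound c (Suc j) + 2 * c ^ 4 + 2 * c\<^sup>2 * mse_bound c j (r + 2)) / real n"
proof -
  define x where "x = de_x c t (Suc j)"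
  define y where "y = de_x c t j"
  define G where "G = U - {u, v}"
  define Y where "Y w = {x \<in> G. cavity t w j G x}" for w
  have xy: "0 \<le> x" "x \<le> 1" "0 \<le> y"
    using de_x_bounds[of c t "Suc j"] de_x_bounds[of c t j] c_pos by (auto simp: x_def y_def)
  have G: "G \<subseteq> V" "card (V - G) = r + 2"
  proof -
    have "V - G = insert u (insert v (V - U))" using U uv by (auto simp: G_def)
    then show "card (V - G) = r + 2" using U uv by simp
  qed (use U in \<open>auto simp: G_def\<close>)
  let ?S = "\<lambda>u Y w. of_bool (t \<le> card {x \<in> Y. w {u, x}}) - x :: real"
  have cav: "of_bool (cavity t w (Suc j) (U - {v}) u) - x = ?S u (Y w) w"
    "of_bool (cavity t w (Suc j) (U - {u}) v) - x = ?S v (Y w) w" for w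
  proof -
    have "U - {v} - {u} = G" "U - {u} - {v} = G" by (auto simp: G_def)
    then show "of_bool (cavity t w (Suc j) (U - {v}) u) - x = ?S u (Y w) w"
      "of_bool (cavity t w (Suc j) (U - {u}) v) - x = ?S v (Y w) w"
      by (simp_all add: Y_def conj_ac)
  qed
  let ?D = "discrepancy_bound c (Suc j) / real n"
  let ?du = "\<lambda>w. of_bool (cavity t w (Suc j) U u \<noteq> cavity t w (Suc j) (U - {v}) u) :: real"
  let ?dv = "\<lambda>w. of_bool (cavity t w (Suc j) U v \<noteq> cavity t w (Suc j) (U - {u}) v) :: real"
  have "E (\<lambda>w. (of_bool (cavity t w (Suc j) U u) - x) * (of_bool (cavity t w (Suc j) U v) - x))
      \<le> E (\<lambda>w. ?S u (Y w) w * ?S v (Y w) w + ?du w + ?dv w)"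
    unfolding cav[symmetric]
    by (intro expect_mono finite_code_bits of_bool_diff_mult_le xy)
  also have "\<dots> = E (\<lambda>w. ?S u (Y w) w * ?S v (Y w) w) + E ?du + E ?dv"
    by (simp only: Bochner_Integration.integral_add integrable_bern finite_code_bits)
  also have "E ?du \<le> ?D" using U uv by (intro expect_cavity_discrepancy) auto
  also have "E ?dv \<le> ?D" using U uv by (intro expect_cavity_discrepancy) auto
  also have "E (\<lambda>w. ?S u (Y w) w * ?S v (Y w) w) =
      E (\<lambda>w. (binomial_tail p t (card (Y w)) - x)\<^sup>2)"
  proof (rule expect_substitute[where W = G and B = "{e. u \<in> e \<or> v \<in> e}" and C = "{e. e \<subseteq> G}"
        and Y = Y and G = "\<lambda>y w. ?S u y w * ?S v y w" and h = "\<lambda>y. (binomial_tail p t (card y) - x)\<^sup>2"])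
    show "finite G" using G finite_subset by blast
    show "depends_on Y {e. e \<subseteq> G}"
    proof (rule depends_onI)
      fix w w' :: "nat set \<Rightarrow> bool" assume "\<And>e. e \<in> {e. e \<subseteq> G} \<Longrightarrow> w e = w' e"
      then show "Y w = Y w'" unfolding Y_def
        by (intro Collect_cong conj_cong refl) (rule depends_onD[OF depends_on_cavity])
    qed
    fix z assume z: "z \<subseteq> G"
    have dep: "depends_on (?S u z) {{u, x} | x. x \<in> z}" "depends_on (?S v z) {{v, x} | x. x \<in> z}"
      by (rule depends_on_comp[OF depends_on_star])+
    show "depends_on (\<lambda>w. ?S u z w * ?S v z w) {e. u \<in> e \<or> v \<in> e}"
      by (intro depends_on_comp2[where h = "(*)"] depends_on_mono[OF dep(1)] depends_on_mono[OF dep(2)]) auto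
    have S: "E (?S q z) = binomial_tail p t (card z) - x" if "q \<in> {u, v}" for q
    proof -
      have "E (?S q z) = E (\<lambda>w. of_bool (t \<le> card {x \<in> z. w {q, x}})) - E (\<lambda>_. x)"
        by (intro Bochner_Integration.integral_diff integrable_bern finite_code_bits)
      moreover have "q \<in> V" "z \<subseteq> V - {q}" using that U uv z G by (auto simp: G_def)
      ultimately show ?thesis using expect_star[of q z t] by simp
    qed
    \<comment> \<open>The stars of \<open>u\<close> and \<open>v\<close> over \<open>z\<close> share
      no edge, because \<open>z\<close> contains neither vertex.\<close>
    have "E (\<lambda>w. ?S u z w * ?S v z w) = E (?S u z) * E (?S v z)"
      using z uv by (intro expect_indep[OF finite_code_bits dep]) (auto simp: doubleton_eq_iff G_def)
    then show "E (\<lambda>w. ?S u z w * ?S v z w) = (binomial_tail p t (card z) - x)\<^sup>2"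
      by (simp only: S insertI1 insertI2 power2_eq_square)
  qed (auto simp: Y_def G_def)
  also have "\<dots> \<le> E (\<lambda>w. 2 * c ^ 4 / real n + 2 * c\<^sup>2 * (real (card (Y w)) / real n - y)\<^sup>2)"
  proof (rule expect_mono[OF finite_code_bits])
    fix w
    let ?b = "real (card (Y w)) / real n - y"
    have "card (Y w) \<le> card V" using G by (intro card_mono) (auto simp: Y_def)
    then have "\<bar>binomial_tail p t (card (Y w)) - poisson_tail t (c * y)\<bar> \<le> c\<^sup>2 / real n + c * \<bar>?b\<bar>"
      using c_pos c_le n_pos xy by (intro binomial_tail_de) auto
    then have "(binomial_tail p t (card (Y w)) - x)\<^sup>2 \<le> (c\<^sup>2 / real n + c * \<bar>?b\<bar>)\<^sup>2"
      by (simp add: x_def y_def abs_le_square_iff[symmetric])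
    also have "\<dots> \<le> 2 * (c\<^sup>2 / real n)\<^sup>2 + 2 * (c * \<bar>?b\<bar>)\<^sup>2"
      by (rule power2_add_le)
    \<comment> \<open>The squared Poisson error has order \<open>1 / n^2\<close>; order
      \<open>1 / n\<close> suffices here.\<close>
    also have "(c\<^sup>2 / real n)\<^sup>2 = (c ^ 4 / real n) * (1 / real n)"
      by (simp add: power2_eq_square power4_eq_xxxx)
    also have "\<dots> \<le> (c ^ 4 / real n) * 1"
      using n_pos by (intro mult_left_mono) auto
    finally show "(binomial_tail p t (card (Y w)) - x)\<^sup>2 \<le> 2 * c ^ 4 / real n + 2 * c\<^sup>2 * ?b\<^sup>2"
      by (simp add: power_mult_distrib)
  qed
  also have "\<dots> = 2 * c ^ 4 / real n + 2 * c\<^sup>2 * E (\<lambda>w. (real (card (Y w)) / real n - y)\<^sup>2)"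
    by (simp add: Bochner_Integration.integral_add)
  also have "E (\<lambda>w. (real (card (Y w)) / real n - y)\<^sup>2) \<le> mse_bound c j (r + 2) / real n"
    unfolding Y_def y_def by (rule IH[OF G])
  finally show ?thesis
    by (simp add: x_def[symmetric] mult_left_mono add_divide_distrib del: discrepancy_bound.simps de_x.simps cavity.simps)
qed

lemma mse_bound_nonneg: "0 \<le> mse_bound c j r"
proof -
  have "0 \<le> discrepancy_bound c k" for k by (induction k) (use c_pos in auto)
  then show ?thesis
    by (induction j arbitrary: r) (use c_pos in \<open>auto simp del: discrepancy_bound.simps\<close>)
qed

text \<open>
  Vertices outside \<open>U\<close> are counted as not sending a message, so that the sum ranges over \<open>V\<close> and the
  normalisation is by \<open>n\<close>; only the \<open>O(n)\<close> pairs that are not two distinct vertices of \<open>U\<close> suffer.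
\<close>

lemma mse_cavity:
  "U \<subseteq> V \<Longrightarrow> card (V - U) = r \<Longrightarrow>
    E (\<lambda>w. (real (card {u \<in> U. cavity t w j U u}) / real n - de_x c t j)\<^sup>2) \<le> mse_bound c j r / real n"
proof (induction j arbitrary: U r)
  case 0
  \<comment> \<open>Every vertex of \<open>U\<close> sends the initial message, so the deviation is
    exactly \<open>r / n\<close>.\<close>
  have "card U = n - r" "r \<le> n"
    using 0 card_Diff_subset[of U V] card_mono[of V U] finite_subset[of U V] by auto
  then have "real (card U) / real n - 1 = - (real r / real n)"
    using n_pos by (simp add: of_nat_diff diff_divide_distrib)
  moreover have "(real r / real n)\<^sup>2 \<le> (real r)\<^sup>2 / real n"
  proof -
    have "(real r / real n)\<^sup>2 = (real r)\<^sup>2 / real n * (1 / real n)"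
      by (simp add: power2_eq_square)
    also have "\<dots> \<le> (real r)\<^sup>2 / real n * 1" using n_pos by (intro mult_left_mono) auto
    finally show ?thesis by simp
  qed
  ultimately show ?case by simp
next
  case (Suc j)
  define x where "x = de_x c t (Suc j)"
  have x: "0 \<le> x" "x \<le> 1" using de_x_bounds[of c t "Suc j"] c_pos by (auto simp: x_def)
  define F where "F u w = of_bool (u \<in> U \<and> cavity t w (Suc j) U u) - x" for u w
  define K where "K = (2 * discrepancy_bound c (Suc j) + 2 * c ^ 4 + 2 * c\<^sup>2 * mse_bound c j (r + 2)) / real n"
  have K0: "0 \<le> K"
  proof -
    have "0 \<le> discrepancy_bound c k" for k by (induction k) (use c_pos in auto)
    then show ?thesis
      unfolding K_def using c_pos mse_bound_nonneg by (intro divide_nonneg_nonneg add_nonneg_nonneg mult_nonneg_nonneg) auto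
  qed
  have F1: "\<bar>F u w\<bar> \<le> 1" for u w using x by (auto simp: F_def)
  have sq: "(real (card {u \<in> U. cavity t w (Suc j) U u}) / real n - x)\<^sup>2 =
      (\<Sum>u\<in>V. \<Sum>v\<in>V. F u w * F v w) / (real n)\<^sup>2" for w
  proof -
    have "{u \<in> U. cavity t w (Suc j) U u} = V \<inter> {u. u \<in> U \<and> cavity t w (Suc j) U u}"
      using Suc.prems by auto
    then have "real (card {u \<in> U. cavity t w (Suc j) U u}) = (\<Sum>u\<in>V. of_bool (u \<in> U \<and> cavity t w (Suc j) U u))"
      by (simp del: cavity.simps)
    then have "real (card {u \<in> U. cavity t w (Suc j) U u}) / real n - x = (\<Sum>u\<in>V. F u w) / real n"
      using n_pos by (simp add: F_def sum_subtractf field_simps del: cavity.simps)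
    then show ?thesis by (simp only: power_divide) (simp add: power2_eq_square sum_product)
  qed
  have pair: "E (\<lambda>w. F u w * F v w) \<le> K + (of_bool (u = v) + of_bool (u \<notin> U) + of_bool (v \<notin> U))"
    if "u \<in> V" "v \<in> V" for u v
  proof (cases "u \<noteq> v \<and> u \<in> U \<and> v \<in> U")
    case True
    have "E (\<lambda>w. F u w * F v w) \<le> K"
      unfolding F_def x_def K_def using True expect_pair_deviation[OF Suc.prems _ _ _ Suc.IH, of u v]
      by (simp del: cavity.simps discrepancy_bound.simps de_x.simps)
    then show ?thesis using True by simp
  next
    case False
    have "F u w * F v w \<le> 1" for w
      using mult_mono[OF F1[of u w] F1[of v w]] abs_le_D1[of "F u w * F v w" 1] by (simp add: abs_mult)
    then have "E (\<lambda>w. F u w * F v w) \<le> E (\<lambda>w. 1)" by (intro expect_mono) auto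
    then show ?thesis using False K0 by auto
  qed
  have "E (\<lambda>w. (real (card {u \<in> U. cavity t w (Suc j) U u}) / real n - x)\<^sup>2) =
      E (\<lambda>w. \<Sum>u\<in>V. \<Sum>v\<in>V. F u w * F v w) / (real n)\<^sup>2"
    unfolding sq by simp
  also have "E (\<lambda>w. \<Sum>u\<in>V. \<Sum>v\<in>V. F u w * F v w) = (\<Sum>u\<in>V. \<Sum>v\<in>V. E (\<lambda>w. F u w * F v w))"
    by (simp add: expect_sum)
  also have "\<dots> \<le> (\<Sum>u\<in>V. \<Sum>v\<in>V. K + (of_bool (u = v) + of_bool (u \<notin> U) + of_bool (v \<notin> U)))"
    by (intro sum_mono pair)
  \<comment> \<open>The trivial bound 1 on degenerate pairs adds \<open>n + 2 n r\<close> in total;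
    division by \<open>n^2\<close> turns this into the term \<open>1 + 2 r\<close> of
    \<open>mse_bound\<close>.\<close>
  also have "\<dots> = real n * real n * K + (real n + real n * real r + real n * real r)"
  proof -
    have "(\<Sum>v\<in>V. of_bool (v \<notin> U)) = real r" using Suc.prems by (simp add: Int_def set_diff_eq)
    moreover have "(\<Sum>v\<in>V. of_bool (u = v)) = (1 :: real)" if "u \<in> V" for u
      using that by (simp add: of_bool_def)
    ultimately show ?thesis
      by (simp add: sum.distrib sum_distrib_left[symmetric] del: sum_of_bool_eq)
  qed
  also have "\<dots> / (real n)\<^sup>2 = K + (1 + 2 * real r) / real n"
    using n_pos by (simp add: field_simps power2_eq_square)
  also have "\<dots> = mse_bound c (Suc j) r / real n"
    by (simp add: K_def add_divide_distrib)
  finally show ?case by (simp add: x_def divide_right_mono del: cavity.simps de_x.simps mse_bound.simps)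
qed

section \<open>Convergence of the mean\<close>

lemma expect_root_cavity:
  assumes "v \<in> V"
  shows "\<bar>E (\<lambda>w. of_bool (root_cavity V t w j v)) - de_z c t (Suc j)\<bar> \<le>
    c\<^sup>2 / real n + c * (1 + mse_bound c j 1) / (2 * sqrt (real n))"
proof -
  define x where "x = de_x c t j"
  define G where "G = V - {v}"
  define Y where "Y w = {u \<in> G. cavity t w j G u}" for w
  define d where "d w = real (card (Y w)) / real n - x" for w
  have x: "0 \<le> x" using de_x_bounds[of c t j] c_pos by (auto simp: x_def)
  have "E (\<lambda>w. of_bool (root_cavity V t w j v)) =
      E (\<lambda>w. of_bool (Suc t \<le> card {x \<in> Y w. w {v, x}}))"
    by (simp add: root_cavity_def Y_def G_def conj_ac)
  also have "\<dots> = E (\<lambda>w. binomial_tail p (Suc t) (card (Y w)))"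
  proof (rule expect_substitute[where W = G and B = "{e. v \<in> e}" and C = "{e. e \<subseteq> G}"
        and Y = Y and G = "\<lambda>y w. of_bool (Suc t \<le> card {x \<in> y. w {v, x}})"
        and h = "\<lambda>y. binomial_tail p (Suc t) (card y)"])
    show "depends_on Y {e. e \<subseteq> G}"
    proof (rule depends_onI)
      fix w w' :: "nat set \<Rightarrow> bool" assume "\<And>e. e \<in> {e. e \<subseteq> G} \<Longrightarrow> w e = w' e"
      then show "Y w = Y w'" unfolding Y_def
        by (intro Collect_cong conj_cong refl) (rule depends_onD[OF depends_on_cavity])
    qed
    fix z assume z: "z \<subseteq> G"
    show "depends_on (\<lambda>w. of_bool (Suc t \<le> card {x \<in> z. w {v, x}}) :: real) {e. v \<in> e}"
      by (rule depends_on_mono[OF depends_on_star]) auto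
    show "E (\<lambda>w. of_bool (Suc t \<le> card {x \<in> z. w {v, x}})) = binomial_tail p (Suc t) (card z)"
      using z assms by (intro expect_star) (auto simp: G_def)
  qed (auto simp: Y_def G_def)
  finally have "\<bar>E (\<lambda>w. of_bool (root_cavity V t w j v)) - de_z c t (Suc j)\<bar> =
      \<bar>E (\<lambda>w. binomial_tail p (Suc t) (card (Y w)) - poisson_tail (Suc t) (c * x))\<bar>"
    by (simp add: de_z_def x_def)
  also have "\<dots> \<le> E (\<lambda>w. \<bar>binomial_tail p (Suc t) (card (Y w)) - poisson_tail (Suc t) (c * x)\<bar>)"
    by (rule integral_abs_bound)
  also have "\<dots> \<le> E (\<lambda>w. c\<^sup>2 / real n + c / (2 * sqrt (real n)) + c * sqrt (real n) / 2 * (d w)\<^sup>2)"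
  proof (rule expect_mono[OF finite_code_bits])
    fix w
    have "card (Y w) \<le> card V" by (intro card_mono) (auto simp: Y_def G_def)
    then have "\<bar>binomial_tail p (Suc t) (card (Y w)) - poisson_tail (Suc t) (c * x)\<bar> \<le> c\<^sup>2 / real n + c * \<bar>d w\<bar>"
      unfolding d_def using c_pos c_le n_pos x by (intro binomial_tail_de) auto
    \<comment> \<open>From the square of \<open>s * \<bar>d w\<bar> - 1\<close>. The weight
      \<open>s = sqrt n\<close> balances the two terms, since the mean square of \<open>d\<close> is
      of order \<open>1 / n\<close>.\<close>
    also have "\<bar>d w\<bar> \<le> 1 / (2 * sqrt (real n)) + sqrt (real n) / 2 * (d w)\<^sup>2"
    proof -
      define s where "s = sqrt (real n)"
      have s: "s > 0" using n_pos by (simp add: s_def)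
      have "0 \<le> (s * \<bar>d w\<bar> - 1)\<^sup>2" by simp
      then have "2 * s * \<bar>d w\<bar> \<le> 1 + s\<^sup>2 * (d w)\<^sup>2"
        by (simp add: power2_eq_square algebra_simps)
      then have "\<bar>d w\<bar> \<le> (1 + s\<^sup>2 * (d w)\<^sup>2) / (2 * s)" using s by (simp add: field_simps)
      also have "\<dots> = 1 / (2 * s) + s / 2 * (d w)\<^sup>2" using s by (simp add: field_simps power2_eq_square)
      finally show ?thesis by (simp only: s_def)
    qed
    finally show "\<bar>binomial_tail p (Suc t) (card (Y w)) - poisson_tail (Suc t) (c * x)\<bar> \<le>
        c\<^sup>2 / real n + c / (2 * sqrt (real n)) + c * sqrt (real n) / 2 * (d w)\<^sup>2"
      using c_pos by (simp add: mult_left_mono distrib_left)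
  qed
  also have "\<dots> = c\<^sup>2 / real n + c / (2 * sqrt (real n)) + c * sqrt (real n) / 2 * E (\<lambda>w. (d w)\<^sup>2)"
    by (simp add: Bochner_Integration.integral_add)
  also have "E (\<lambda>w. (d w)\<^sup>2) \<le> mse_bound c j 1 / real n"
  proof -
    have "V - G = {v}" using assms by (auto simp: G_def)
    then show ?thesis unfolding d_def Y_def x_def by (intro mse_cavity) (auto simp: G_def)
  qed
  also have "c\<^sup>2 / real n + c / (2 * sqrt (real n)) + c * sqrt (real n) / 2 * (mse_bound c j 1 / real n) =
      c\<^sup>2 / real n + c * (1 + mse_bound c j 1) / (2 * sqrt (real n))"
  proof -
    have "sqrt (real n) / real n = 1 / sqrt (real n)"
      using n_pos by (simp add: real_div_sqrt divide_simps)
    moreover have "c * sqrt (real n) / 2 * (mse_bound c j 1 / real n) =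
        c * mse_bound c j 1 / 2 * (sqrt (real n) / real n)" by simp
    ultimately have "c * sqrt (real n) / 2 * (mse_bound c j 1 / real n) =
        c * mse_bound c j 1 / (2 * sqrt (real n))" by simp
    then show ?thesis by (simp add: distrib_left add_divide_distrib)
  qed
  finally show ?thesis using c_pos by (simp add: mult_left_mono)
qed

text \<open>Three errors add up: short cycles, the Poisson approximation, and the fluctuation of the
  fraction of senders, which dominates with order \<open>1 / sqrt n\<close>.\<close>

lemma expect_failed_fraction:
  "\<bar>E (failed_fraction n t (Suc j)) - de_z c t (Suc j)\<bar> \<le>
    cycle_bound c (Suc j) 0 / real n + c\<^sup>2 / real n + c * (1 + mse_bound c j 1) / (2 * sqrt (real n))"
    (is "_ \<le> ?B")
proof -
  let ?s = "\<lambda>v w. of_bool (survive V t w (Suc j) v) :: real"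
  let ?r = "\<lambda>v w. of_bool (root_cavity V t w j v) :: real"
  have "E (failed_fraction n t (Suc j)) = E (\<lambda>w. (\<Sum>v\<in>V. ?s v w) / real n)"
    by (simp add: failed_fraction_survive[abs_def] Int_def del: survive.simps)
  also have "\<dots> = (\<Sum>v\<in>V. E (?s v)) / real n"
    by (simp add: expect_sum del: survive.simps sum_of_bool_eq)
  finally have "E (failed_fraction n t (Suc j)) - de_z c t (Suc j) =
      (\<Sum>v\<in>V. E (?s v) - de_z c t (Suc j)) / real n"
    using n_pos by (simp add: sum_subtractf field_simps del: survive.simps)
  then have "\<bar>E (failed_fraction n t (Suc j)) - de_z c t (Suc j)\<bar> =
      \<bar>(\<Sum>v\<in>V. E (?s v) - de_z c t (Suc j)) / real n\<bar>"
    by (rule arg_cong)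
  also have "\<dots> \<le> (\<Sum>v\<in>V. ?B) / real n"
    unfolding abs_divide abs_of_nat
  proof (rule divide_right_mono)
    have "\<bar>E (?s v) - de_z c t (Suc j)\<bar> \<le> ?B" if v: "v \<in> V" for v
    proof -
      have "\<bar>E (?s v) - E (?r v)\<bar> = \<bar>E (\<lambda>w. ?s v w - ?r v w)\<bar>"
        by (subst Bochner_Integration.integral_diff) (auto simp del: survive.simps)
      also have "\<dots> \<le> E (\<lambda>w. \<bar>?s v w - ?r v w\<bar>)" by (rule integral_abs_bound)
      also have "\<dots> \<le> E (\<lambda>w. of_bool (short_cycle V w (Suc j) V v))"
        using v by (intro expect_mono survive_root_cavity_discrepancy) auto
      also have "\<dots> \<le> cycle_bound c (Suc j) 0 / real n"
        using v by (intro expect_short_cycle) auto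
      finally show ?thesis using expect_root_cavity[OF v, of t j] by linarith
    qed
    then show "\<bar>\<Sum>v\<in>V. E (?s v) - de_z c t (Suc j)\<bar> \<le> (\<Sum>v\<in>V. ?B)"
      by (intro order.trans[OF sum_abs] sum_mono)
  qed simp
  also have "\<dots> = ?B" using n_pos by simp
  finally show ?thesis .
qed

end

subsection \<open>Concentration\<close>

definition graph_degree :: "nat set \<Rightarrow> (nat set \<Rightarrow> bool) \<Rightarrow> nat \<Rightarrow> nat" where
  "graph_degree V w v = card {x \<in> V - {v}. w {v, x}}"

text \<open>Degrees are taken in the original graph and not updated during the deletion, so a
  flipped bit \<open>e\<close> influences only edges that meet \<open>e\<close>.\<close>

definition truncate :: "nat set \<Rightarrow> nat \<Rightarrow> (nat set \<Rightarrow> bool) \<Rightarrow> nat set \<Rightarrow> bool" where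
  "truncate V D w e \<longleftrightarrow> w e \<and> (\<forall>v\<in>e. graph_degree V w v \<le> D)"

lemma graph_degree_truncate:
  assumes "finite V"
  shows "graph_degree V (truncate V D w) v \<le> D"
proof (cases "graph_degree V w v \<le> D")
  case True
  have "graph_degree V (truncate V D w) v \<le> graph_degree V w v"
    unfolding graph_degree_def using assms by (intro card_mono) (auto simp: truncate_def)
  then show ?thesis using True by simp
next
  case False
  then show ?thesis by (simp add: graph_degree_def[of V "truncate V D w"] truncate_def)
qed

lemma survive_truncate:
  assumes "\<forall>v\<in>V. graph_degree V w v \<le> D"
  shows "v \<in> V \<Longrightarrow> survive V t (truncate V D w) l v \<longleftrightarrow> survive V t w l v"
proof (induction l arbitrary: v)
  case (Suc l)
  have "truncate V D w {v, x} = w {v, x}" if "x \<in> V" for x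
    using assms Suc.prems that by (auto simp: truncate_def)
  then have "{x \<in> V - {v}. truncate V D w {v, x} \<and> survive V t (truncate V D w) l x} =
      {x \<in> V - {v}. w {v, x} \<and> survive V t w l x}"
    using Suc.IH by blast
  then show ?case by simp
qed simp

lemma truncate_update:
  assumes "x \<notin> e" "y \<notin> e"
  shows "truncate V D (w(e := b)) {x, y} = truncate V D w {x, y}"
proof -
  have ne: "{v, z} \<noteq> e" if "v \<notin> e" for v z using that by auto
  have "graph_degree V (w(e := b)) v = graph_degree V w v" if "v \<notin> e" for v
    using ne[OF that] by (simp add: graph_degree_def)
  then show ?thesis using assms ne[OF assms(1), of y] by (simp add: truncate_def)
qed

text \<open>The truncated graphs agree on edges disjoint from \<open>e\<close> and have degrees at
  most \<open>D\<close>, so \<open>survive_difference\<close> applies with the two endpoints of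
  \<open>e\<close> as exceptional vertices.\<close>

lemma survive_truncate_lipschitz:
  assumes "finite V" "card e = 2"
  shows "\<bar>real (card {v \<in> V. survive V t (truncate V D (w(e := b))) l v}) -
      real (card {v \<in> V. survive V t (truncate V D (w(e := b'))) l v})\<bar>
    \<le> 2 * (1 + 2 * real D) * (1 + real D) ^ l"
proof -
  let ?A = "\<lambda>b. {v \<in> V. survive V t (truncate V D (w(e := b))) l v}"
  let ?d = "{v \<in> V. survive V t (truncate V D (w(e := b))) l v \<noteq>
    survive V t (truncate V D (w(e := b'))) l v}"
  have e: "finite e" using assms(2) card.infinite by fastforce
  have "card ?d \<le> card e * (1 + 2 * D) * (1 + D) ^ l"
  proof (rule survive_difference[OF assms(1) e])
    show "truncate V D (w(e := b)) {x, y} = truncate V D (w(e := b')) {x, y}"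
      if "x \<notin> e" "y \<notin> e" for x y using that by (simp add: truncate_update)
  qed (use graph_degree_truncate[OF assms(1)] in \<open>simp_all add: graph_degree_def\<close>)
  then have "real (card ?d) \<le> real (2 * (1 + 2 * D) * (1 + D) ^ l)"
    unfolding assms(2) of_nat_le_iff .
  also have "\<dots> = 2 * (1 + 2 * real D) * (1 + real D) ^ l" by (simp add: algebra_simps)
  finally have "real (card ?d) \<le> 2 * (1 + 2 * real D) * (1 + real D) ^ l" .
  moreover have "card (?A b) \<le> card (?A b') + card ?d" "card (?A b') \<le> card (?A b) + card ?d"
  proof -
    have "card (?A b) \<le> card (?A b' \<union> ?d)" "card (?A b') \<le> card (?A b \<union> ?d)"
      using assms(1) by (auto intro!: card_mono)
    then show "card (?A b) \<le> card (?A b') + card ?d" "card (?A b') \<le> card (?A b) + card ?d"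
      using card_Un_le[of "?A b'" ?d] card_Un_le[of "?A b" ?d] by linarith+
  qed
  ultimately show ?thesis by linarith
qed

context sparse_graph
begin

lemma graph_degree_eq_sum: "real (graph_degree V w v) = (\<Sum>x\<in>V - {v}. of_bool (w {v, x}))"
  by (simp add: graph_degree_def Int_def)

text \<open>One \<open>c\<close> bounds the mean degree; the other is the exponent
  \<open>p * n\<close> from \<open>expect_exp_deviation\<close>, to which only the at most
  \<open>n\<close> bits at \<open>v\<close> contribute.\<close>

lemma expect_graph_degree_tail:
  assumes v: "v \<in> V"
  shows "E (\<lambda>w. of_bool (D < graph_degree V w v)) \<le> exp (2 * c - real D)"
proof -
  let ?f = "\<lambda>w. real (graph_degree V w v)"
  let ?K = "\<lambda>e. of_bool (v \<in> e) :: real"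
  have "E ?f = (\<Sum>x\<in>V - {v}. E (\<lambda>w. of_bool (w {v, x})))"
    unfolding graph_degree_eq_sum by (rule expect_sum) simp
  also have "\<dots> = (\<Sum>x\<in>V - {v}. p)"
    using v by (intro sum.cong refl expect_edge) auto
  also have "\<dots> = (real n - 1) * p" using v n_pos by (simp add: of_nat_diff)
  also have "\<dots> \<le> real n * p" using p_bounds by (intro mult_right_mono) auto
  finally have Ef: "E ?f \<le> c" by (simp only: n_mult_p)
  have "E (\<lambda>w. exp (?f w - E ?f)) \<le> exp (p * (\<Sum>e\<in>code_bits n. (?K e)\<^sup>2))"
  proof (rule expect_exp_deviation[OF finite_code_bits p_bounds])
    fix e w assume e: "e \<in> code_bits n"
    have "\<bar>?f (w(e := True)) - ?f (w(e := False))\<bar> =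
        \<bar>\<Sum>x\<in>V - {v}. of_bool ((w(e := True)) {v, x}) - of_bool ((w(e := False)) {v, x})\<bar>"
      unfolding graph_degree_eq_sum sum_subtractf ..
    also have "\<dots> \<le> (\<Sum>x\<in>V - {v}. of_bool ({v, x} = e))"
      by (intro order.trans[OF sum_abs] sum_mono) auto
    also have "\<dots> = real (card {x \<in> V - {v}. {v, x} = e})" by (simp add: Int_def)
    also have "\<dots> \<le> ?K e"
    proof (cases "v \<in> e")
      case True
      have "finite e" "card (e - {v}) = 1"
        using e True by (auto simp: code_bits_def card_ge_0_finite)
      then have "card {x \<in> V - {v}. {v, x} = e} \<le> 1"
        using card_mono[of "e - {v}" "{x \<in> V - {v}. {v, x} = e}"] by auto
      then show ?thesis using True by simp
    next
      case False
      then have "{x \<in> V - {v}. {v, x} = e} = {}" by auto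
      then show ?thesis by (simp only: card.empty) simp
    qed
    finally show "\<bar>?f (w(e := True)) - ?f (w(e := False))\<bar> \<le> ?K e" .
  qed simp
  also have "(\<Sum>e\<in>code_bits n. (?K e)\<^sup>2) = real (card (code_bits n \<inter> {e. v \<in> e}))"
    by (simp flip: of_bool_conj add: power2_eq_square)
  finally have mgf: "E (\<lambda>w. exp (?f w - E ?f)) \<le> exp (p * real (card (code_bits n \<inter> {e. v \<in> e})))" .
  have "card (code_bits n \<inter> {e. v \<in> e}) \<le> n"
  proof -
    have "code_bits n \<inter> {e. v \<in> e} \<subseteq> (\<lambda>x. {v, x}) ` V"
      by (auto simp: code_bits_def component_codes_def card_2_iff)
    then have "card (code_bits n \<inter> {e. v \<in> e}) \<le> card ((\<lambda>x. {v, x}) ` V)"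
      by (intro card_mono) auto
    also have "\<dots> \<le> card V" by (rule card_image_le) simp
    finally show ?thesis by simp
  qed
  then have "p * real (card (code_bits n \<inter> {e. v \<in> e})) \<le> p * real n"
    using p_bounds by (intro mult_left_mono) auto
  then have mgf: "E (\<lambda>w. exp (?f w - E ?f)) \<le> exp (p * real n)"
    using mgf by (meson exp_le_cancel_iff order.trans)
  have "E (\<lambda>w. of_bool (D < graph_degree V w v)) \<le> E (\<lambda>w. exp (c - real D) * exp (?f w - E ?f))"
  proof (rule expect_mono[OF finite_code_bits])
    fix w
    have "of_bool (D < graph_degree V w v) \<le> exp (?f w - real D)" by simp
    also have "\<dots> \<le> exp (c - real D) * exp (?f w - E ?f)"
      using Ef by (simp flip: exp_add)
    finally show "of_bool (D < graph_degree V w v) \<le> exp (c - real D) * exp (?f w - E ?f)" .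
  qed
  also have "\<dots> = exp (c - real D) * E (\<lambda>w. exp (?f w - E ?f))" by simp
  also have "\<dots> \<le> exp (c - real D) * exp (p * real n)" using mgf by (intro mult_left_mono) auto
  also have "\<dots> = exp (2 * c - real D)" using n_pos by (simp flip: exp_add)
  finally show ?thesis .
qed

lemma lipschitz_tail_bound:
  assumes "1 \<le> K" "0 < a"
    and lip: "\<And>e w. e \<in> code_bits n \<Longrightarrow> \<bar>f (w(e := True)) - f (w(e := False))\<bar> \<le> K"
  shows "E (\<lambda>w. of_bool (a * real n \<le> f w - E f)) \<le> exp (- (a * min 1 (a / c) / 2) * (real n / K\<^sup>2))"
proof -
  \<comment> \<open>\<open>\<theta>\<close> is the Chernoff parameter. The bound
    \<open>s \<le> 1\<close> ensures \<open>\<theta> * K \<le> 1\<close>, and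
    \<open>c * s \<le> a\<close> keeps the quadratic term of the exponent below half of the linear
    one.\<close>
  define s where "s = min 1 (a / c)"
  define \<theta> where "\<theta> = s / K\<^sup>2"
  have s: "0 < s" "s \<le> 1" "c * s \<le> a"
    using assms(2) c_pos by (auto simp: s_def min_def field_simps)
  have l0: "0 < \<theta>" using s assms by (simp add: \<theta>_def)
  have lK: "\<theta> * K \<le> 1" "\<theta>\<^sup>2 * K\<^sup>2 = s\<^sup>2 / K\<^sup>2"
    using s assms by (auto simp: \<theta>_def power2_eq_square divide_simps)
  let ?g = "\<lambda>w. \<theta> * f w"
  have "E (\<lambda>w. exp (?g w - E ?g)) \<le> exp (p * (\<Sum>e\<in>code_bits n. (\<theta> * K)\<^sup>2))"
  proof (rule expect_exp_deviation[OF finite_code_bits p_bounds])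
    fix e w assume "e \<in> code_bits n"
    then have "\<theta> * \<bar>f (w(e := True)) - f (w(e := False))\<bar> \<le> \<theta> * K"
      using l0 by (intro mult_left_mono lip) auto
    then show "\<bar>?g (w(e := True)) - ?g (w(e := False))\<bar> \<le> \<theta> * K"
      using l0 by (simp add: abs_mult flip: right_diff_distrib)
  qed (rule lK)
  also have "p * (\<Sum>e\<in>code_bits n. (\<theta> * K)\<^sup>2) = p * real (n choose 2) * (s\<^sup>2 / K\<^sup>2)"
    by (simp add: card_code_bits power_mult_distrib lK)
  also have "\<dots> \<le> (c * real n / 2) * (s\<^sup>2 / K\<^sup>2)"
  proof (rule mult_right_mono)
    have "2 * (n choose 2) \<le> n * (n - 1)" by (simp add: choose_two)
    also have "\<dots> \<le> n * n" by (intro mult_left_mono) auto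
    finally have "2 * (n choose 2) \<le> n * n" .
    then have "2 * real (n choose 2) \<le> real n * real n"
      by (metis of_nat_le_iff of_nat_mult of_nat_numeral)
    then have "p * (2 * real (n choose 2)) \<le> p * (real n * real n)"
      using p_bounds by (intro mult_left_mono) auto
    then show "p * real (n choose 2) \<le> c * real n / 2" using n_pos by (simp add: mult_ac)
  qed simp
  finally have mgf: "E (\<lambda>w. exp (?g w - E ?g)) \<le> exp ((c * real n / 2) * (s\<^sup>2 / K\<^sup>2))" by simp
  have "E (\<lambda>w. of_bool (a * real n \<le> f w - E f)) \<le> E (\<lambda>w. exp (- \<theta> * a * real n) * exp (?g w - E ?g))"
  proof (rule expect_mono[OF finite_code_bits])
    fix w
    have "1 \<le> exp (\<theta> * (f w - E f - a * real n))" if "a * real n \<le> f w - E f"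
      using that l0 by simp
    then have "of_bool (a * real n \<le> f w - E f) \<le> exp (\<theta> * (f w - E f - a * real n))" by auto
    also have "\<theta> * (f w - E f - a * real n) = - \<theta> * a * real n + (?g w - E ?g)"
      by (simp add: algebra_simps)
    finally show "of_bool (a * real n \<le> f w - E f) \<le> exp (- \<theta> * a * real n) * exp (?g w - E ?g)"
      by (simp only: exp_add)
  qed
  also have "\<dots> = exp (- \<theta> * a * real n) * E (\<lambda>w. exp (?g w - E ?g))" by simp
  also have "\<dots> \<le> exp (- \<theta> * a * real n) * exp ((c * real n / 2) * (s\<^sup>2 / K\<^sup>2))"
    using mgf by (intro mult_left_mono) auto
  also have "\<dots> = exp (- (s * a - s * (c * s) / 2) * (real n / K\<^sup>2))"
    by (simp add: exp_add[symmetric] \<theta>_def algebra_simps power2_eq_square)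
  also have "\<dots> \<le> exp (- (a * s / 2) * (real n / K\<^sup>2))"
  proof -
    have "s * (c * s) \<le> s * a" using s by (intro mult_left_mono) auto
    then have "- (s * a - s * (c * s) / 2) \<le> - (a * s / 2)" by (simp add: algebra_simps)
    then show ?thesis unfolding exp_le_cancel_iff by (rule mult_right_mono) simp
  qed
  finally show ?thesis by (simp add: s_def)
qed

lemma failed_fraction_tail:
  fixes t l D :: nat
  assumes eps: "0 < \<epsilon>" and D: "real n * exp (2 * c - real D) \<le> \<epsilon> / 2"
  defines "K \<equiv> 2 * (1 + 2 * real D) * (1 + real D) ^ l"
  shows "measure_pmf.prob (bern (code_bits n) p)
      {w. \<bar>failed_fraction n t l w - E (failed_fraction n t l)\<bar> \<ge> \<epsilon>}
    \<le> real n * exp (2 * c - real D) +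
      2 * exp (- (\<epsilon> / 2 * min 1 (\<epsilon> / 2 / c) / 2) * (real n / K\<^sup>2))"
proof -
  let ?W = "failed_fraction n t l"
  define f where "f w = real (card {v \<in> V. survive V t (truncate V D w) l v})" for w
  let ?W' = "\<lambda>w. f w / real n"
  let ?B = "\<lambda>w. of_bool (\<exists>v\<in>V. D < graph_degree V w v) :: real"
  have K1: "1 \<le> K"
  proof -
    have "1 * 1 \<le> (2 * (1 + 2 * real D)) * (1 + real D) ^ l" by (intro mult_mono) auto
    then show ?thesis by (simp add: K_def)
  qed
  have lip: "\<bar>f (w(e := True)) - f (w(e := False))\<bar> \<le> K" if "e \<in> code_bits n" for e w
    unfolding f_def K_def using that
    by (intro survive_truncate_lipschitz) (auto simp: code_bits_def)
  have EB: "E ?B \<le> real n * exp (2 * c - real D)"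
  proof -
    have "E ?B \<le> E (\<lambda>w. \<Sum>v\<in>V. of_bool (D < graph_degree V w v))"
    proof (rule expect_mono[OF finite_code_bits])
      fix w
      show "?B w \<le> (\<Sum>v\<in>V. of_bool (D < graph_degree V w v))"
      proof (cases "\<exists>v\<in>V. D < graph_degree V w v")
        case True
        then obtain v where "v \<in> V" "D < graph_degree V w v" by blast
        then show ?thesis
          using member_le_sum[of v V "\<lambda>v. of_bool (D < graph_degree V w v) :: real"] True by simp
      qed (simp add: sum_nonneg)
    qed
    also have "\<dots> = (\<Sum>v\<in>V. E (\<lambda>w. of_bool (D < graph_degree V w v)))" by (rule expect_sum) simp
    also have "\<dots> \<le> (\<Sum>v\<in>V. exp (2 * c - real D))" by (intro sum_mono expect_graph_degree_tail)
    finally show ?thesis by simp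
  qed
  have close: "\<bar>?W w - ?W' w\<bar> \<le> ?B w" for w
  proof (cases "\<exists>v\<in>V. D < graph_degree V w v")
    case True
    have "card {v \<in> V. P v} \<le> n" for P
      by (rule order.trans[OF card_mono[of V]]) auto
    then have "0 \<le> ?W w" "?W w \<le> 1" "0 \<le> ?W' w" "?W' w \<le> 1"
      using n_pos by (auto simp: failed_fraction_survive f_def divide_le_eq)
    then show ?thesis using True by auto
  next
    case False
    then have "\<forall>v\<in>V. graph_degree V w v \<le> D" by (auto simp: not_less)
    then have "{v \<in> V. survive V t (truncate V D w) l v} = {v \<in> V. survive V t w l v}"
      using survive_truncate by blast
    then show ?thesis by (simp add: failed_fraction_survive f_def)
  qed
  \<comment> \<open>Both fractions lie in \<open>[0, 1]\<close> and coincide unless some degree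
    exceeds \<open>D\<close>, so truncation moves the mean by at most \<open>\<epsilon> / 2\<close>.
    The other half of \<open>\<epsilon>\<close> is left for the deviation of the truncated
    count.\<close>
  have "\<bar>E ?W - E ?W'\<bar> = \<bar>E (\<lambda>w. ?W w - ?W' w)\<bar>"
    by (subst Bochner_Integration.integral_diff) auto
  also have "\<dots> \<le> E (\<lambda>w. \<bar>?W w - ?W' w\<bar>)" by (rule integral_abs_bound)
  also have "\<dots> \<le> E ?B" by (intro expect_mono close) simp
  also have "\<dots> \<le> \<epsilon> / 2" using EB D by linarith
  finally have means: "\<bar>E ?W - E ?W'\<bar> \<le> \<epsilon> / 2" .
  let ?up = "\<lambda>w. of_bool (\<epsilon> / 2 * real n \<le> f w - E f) :: real"
  \<comment> \<open>The lower tail of \<open>f\<close> is the upper tail of \<open>- f\<close>,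
    which has the same Lipschitz constant.\<close>
  let ?down = "\<lambda>w. of_bool (\<epsilon> / 2 * real n \<le> - f w - E (\<lambda>w. - f w)) :: real"
  have "E (\<lambda>w. of_bool (\<bar>?W w - E ?W\<bar> \<ge> \<epsilon>)) \<le> E (\<lambda>w. ?B w + (?up w + ?down w))"
  proof (rule expect_mono[OF finite_code_bits])
    fix w
    show "of_bool (\<bar>?W w - E ?W\<bar> \<ge> \<epsilon>) \<le> ?B w + (?up w + ?down w)"
    proof (cases "\<bar>?W w - E ?W\<bar> \<ge> \<epsilon> \<and> ?B w = 0")
      case True
      then have "?W w = ?W' w" using close[of w] by auto
      then have "\<epsilon> / 2 \<le> \<bar>?W' w - E ?W'\<bar>" using True means by linarith
      also have "?W' w - E ?W' = (f w - E f) / real n" by (simp add: diff_divide_distrib)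
      also have "\<bar>\<dots>\<bar> = \<bar>f w - E f\<bar> / real n" by simp
      finally have "\<epsilon> / 2 * real n \<le> \<bar>f w - E f\<bar>" using n_pos by (simp add: pos_le_divide_eq)
      then have "\<epsilon> / 2 * real n \<le> f w - E f \<or> \<epsilon> / 2 * real n \<le> - f w - E (\<lambda>w. - f w)"
        by (auto simp: abs_if split: if_splits)
      then have "1 \<le> ?up w + ?down w" by auto
      moreover have "of_bool (\<bar>?W w - E ?W\<bar> \<ge> \<epsilon>) \<le> (1 :: real)" "0 \<le> ?B w" by simp_all
      ultimately show ?thesis by linarith
    next
      case False
      then show ?thesis by (cases "\<exists>v\<in>V. D < graph_degree V w v") auto
    qed
  qed
  also have "\<dots> = E ?B + (E ?up + E ?down)"
    by (simp only: Bochner_Integration.integral_add integrable_bern finite_code_bits)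
  also have "E ?up \<le> exp (- (\<epsilon> / 2 * min 1 (\<epsilon> / 2 / c) / 2) * (real n / K\<^sup>2))"
    using eps lip by (intro lipschitz_tail_bound K1) auto
  also have "E ?down \<le> exp (- (\<epsilon> / 2 * min 1 (\<epsilon> / 2 / c) / 2) * (real n / K\<^sup>2))"
  proof (rule lipschitz_tail_bound[OF K1])
    fix e w assume "e \<in> code_bits n"
    then show "\<bar>- f (w(e := True)) - - f (w(e := False))\<bar> \<le> K" using lip[of e w] by linarith
  qed (use eps in simp)
  finally show ?thesis using EB unfolding prob_eq_expect by linarith
qed

end

section \<open>Choice of the exponents and conclusion\<close>

lemma eventually_sparse_graph:
  assumes "0 < c"
  shows "\<forall>\<^sub>F n in sequentially. sparse_graph n c"
  using eventually_ge_at_top[of "nat \<lceil>c\<rceil>"]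
  by eventually_elim (use assms in \<open>simp add: sparse_graph_def\<close>)

text \<open>The summand 1 in the exponent pays for rounding \<open>n powr (2 * \<delta>)\<close>
  down to an integer \<open>D\<close>. Each of the two terms is eventually at most half of the
  right-hand side, the second because \<open>\<delta> \<le> 1 / 4 < 1 / 2\<close>.\<close>

lemma tail_exponents:
  fixes c g \<epsilon> \<delta> :: real
  assumes "0 < \<delta>" "\<delta> \<le> 1 / 4" "0 < g" "0 < \<epsilon>"
  shows "\<forall>\<^sub>F n in sequentially. real n * exp (2 * c + 1 - real n powr (2 * \<delta>)) \<le> \<epsilon> / 2 \<and>
    real n * exp (2 * c + 1 - real n powr (2 * \<delta>)) + 2 * exp (- g * real n powr (1 / 2))
      \<le> exp (- 1 * real n powr \<delta>)"
proof -
  \<comment> \<open>In the variable \<open>m = n powr \<delta>\<close> the factor \<open>n\<close>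
    becomes a fixed power of \<open>m\<close>, which \<open>exp (- m^2)\<close> absorbs.\<close>
  have "((\<lambda>m. m powr (1 / \<delta>) * exp (2 * c + 1 - m\<^sup>2)) \<longlongrightarrow> 0) at_top"
    "\<forall>\<^sub>F m in at_top. m powr (1 / \<delta>) * exp (2 * c + 1 - m\<^sup>2) \<le> exp (- 1 * m) / 2"
    using assms(1) by real_asymp+
  then have A: "\<forall>\<^sub>F m in at_top. m powr (1 / \<delta>) * exp (2 * c + 1 - m\<^sup>2) < \<epsilon> / 2 \<and>
      m powr (1 / \<delta>) * exp (2 * c + 1 - m\<^sup>2) \<le> exp (- 1 * m) / 2"
    using assms(4) by (intro eventually_conj order_tendstoD) auto
  have lim: "filterlim (\<lambda>n. real n powr \<delta>) at_top sequentially" using assms(1) by real_asymp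
  have B: "\<forall>\<^sub>F n in sequentially. 2 * exp (- g * real n powr (1 / 2)) \<le> exp (- 1 * real n powr (1 / 4)) / 2"
    using assms(3) by real_asymp
  show ?thesis
    using eventually_compose_filterlim[OF A lim] B eventually_gt_at_top[of 0]
  proof eventually_elim
    case (elim n)
    have "(real n powr \<delta>) powr (1 / \<delta>) = real n" "(real n powr \<delta>)\<^sup>2 = real n powr (2 * \<delta>)"
      using assms(1) elim by (simp_all add: powr_powr powr_power mult.commute)
    note eqs = this
    have "exp (- 1 * real n powr (1 / 4)) \<le> exp (- 1 * real n powr \<delta>)"
      using elim assms(2) by (simp add: powr_mono)
    then show ?case using elim(1,2) unfolding eqs by linarith
  qed
qed

theorem theorem1:
  fixes c :: real and t l :: nat
  assumes "c > 0" and "t \<ge> 1" and "l \<ge> 1"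
  shows "((\<lambda>n. measure_pmf.expectation (erasure_channel n (c / real n)) (failed_fraction n t l))
            \<longlonglongrightarrow> de_z c t l)
    \<and> (\<forall>\<epsilon>>0. \<exists>\<delta>>0. \<exists>\<beta>>0. \<exists>n0::nat. \<forall>n>n0.
          measure_pmf.prob (erasure_channel n (c / real n))
            {\<omega>. \<bar>failed_fraction n t l \<omega>
                 - measure_pmf.expectation (erasure_channel n (c / real n)) (failed_fraction n t l)\<bar> \<ge> \<epsilon>}
          \<le> exp (- \<beta> * real n powr \<delta>))"
proof (intro conjI allI impI)
  obtain j where l: "l = Suc j" using assms(3) by (cases l) auto
  show "(\<lambda>n. measure_pmf.expectation (erasure_channel n (c / real n)) (failed_fraction n t l))
      \<longlonglongrightarrow> de_z c t l"
  proof (rule LIM_zero_cancel, rule Lim_null_comparison)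
    show "\<forall>\<^sub>F n in sequentially.
        norm (measure_pmf.expectation (erasure_channel n (c / real n)) (failed_fraction n t l) - de_z c t l)
        \<le> cycle_bound c (Suc j) 0 / real n + c\<^sup>2 / real n + c * (1 + mse_bound c j 1) / (2 * sqrt (real n))"
      using eventually_sparse_graph[OF assms(1)]
    proof eventually_elim
      case (elim n)
      then show ?case
        using sparse_graph.expect_failed_fraction[of n c t j] by (simp only: erasure_channel_def l real_norm_def)
    qed
    have "(\<lambda>n. A / real n + B / real n + C / (2 * sqrt (real n))) \<longlonglongrightarrow> 0" for A B C :: real
      by real_asymp
    then show "(\<lambda>n. cycle_bound c (Suc j) 0 / real n + c\<^sup>2 / real n +
        c * (1 + mse_bound c j 1) / (2 * sqrt (real n))) \<longlonglongrightarrow> 0" .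
  qed
next
  fix \<epsilon> :: real assume eps: "0 < \<epsilon>"
  \<comment> \<open>\<open>D\<close> will be about \<open>n powr (2 * \<delta>)\<close>, so that the
    Lipschitz constant \<open>K\<close>, of order \<open>D ^ (l + 1)\<close>, is of order
    \<open>n powr (1 / 4)\<close> and \<open>n / K^2\<close> at least of order
    \<open>n powr (1 / 2)\<close>. The spare factor 2 lets \<open>exp (- D)\<close> absorb the
    factor \<open>n\<close>.\<close>
  define \<delta> where "\<delta> = 1 / (8 * real (Suc l))"
  have \<delta>: "0 < \<delta>" "\<delta> \<le> 1 / 4" by (auto simp: \<delta>_def field_simps)
  define \<gamma> where "\<gamma> = \<epsilon> / 2 * min 1 (\<epsilon> / 2 / c) / 2"
  have \<gamma>: "0 < \<gamma>" using eps assms(1) by (simp add: \<gamma>_def)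
  define g where "g = \<gamma> / (2 ^ (l + 3))\<^sup>2"
  have g: "0 < g" using \<gamma> by (simp add: g_def)
  have "\<forall>\<^sub>F n in sequentially. measure_pmf.prob (erasure_channel n (c / real n))
            {\<omega>. \<bar>failed_fraction n t l \<omega>
                 - measure_pmf.expectation (erasure_channel n (c / real n)) (failed_fraction n t l)\<bar> \<ge> \<epsilon>}
          \<le> exp (- 1 * real n powr \<delta>)"
    using eventually_sparse_graph[OF assms(1)] tail_exponents[OF \<delta> g eps, of c] eventually_ge_at_top[of 1]
  proof eventually_elim
    case (elim n)
    define D where "D = nat \<lfloor>real n powr (2 * \<delta>)\<rfloor>"
    define m where "m = real n powr (2 * \<delta>)"
    have m1: "1 \<le> m" using elim \<delta> by (simp add: m_def ge_one_powr_ge_zero)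
    have D: "m - 1 \<le> real D" "real D \<le> m" using m1 by (simp_all add: D_def m_def[symmetric])
    have "exp (2 * c - real D) \<le> exp (2 * c + 1 - m)" using D by simp
    then have nD: "real n * exp (2 * c - real D) \<le> real n * exp (2 * c + 1 - m)"
      by (rule mult_left_mono) simp
    define K where "K = 2 * (1 + 2 * real D) * (1 + real D) ^ l"
    \<comment> \<open>Uses \<open>1 + 2 * D \<le> 4 * m\<close> and
      \<open>1 + D \<le> 2 * m\<close>; the powers of two collect to \<open>2 ^ (l + 3)\<close>,
      whence the denominator of \<open>g\<close>.\<close>
    have "K \<le> 2 * (2 * (2 * m)) * (2 * m) ^ l"
      unfolding K_def using D m1 by (intro mult_mono power_mono) auto
    also have "\<dots> = 2 ^ (l + 2) * (2 * m ^ Suc l)" by (simp add: power_mult_distrib)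
    also have "m ^ Suc l = real n powr (1 / 4)"
    proof -
      have "real (Suc l) * (2 * \<delta>) = 1 / 4" unfolding \<delta>_def by (simp del: of_nat_Suc)
      moreover have "m ^ Suc l = real n powr (real (Suc l) * (2 * \<delta>))"
        unfolding m_def by (rule powr_power) (use elim in simp)
      ultimately show ?thesis by (simp only:)
    qed
    finally have "K\<^sup>2 \<le> (2 ^ (l + 3) * real n powr (1 / 4))\<^sup>2"
      by (intro power_mono) (auto simp: K_def power_add)
    also have "\<dots> = (2 ^ (l + 3))\<^sup>2 * real n powr (1 / 2)"
      using elim by (simp add: power_mult_distrib powr_power)
    finally have K2: "K\<^sup>2 \<le> (2 ^ (l + 3))\<^sup>2 * real n powr (1 / 2)" .
    have K0: "0 < K" by (auto simp: K_def intro!: mult_pos_pos add_pos_nonneg zero_less_power)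
    have "real n / ((2 ^ (l + 3))\<^sup>2 * real n powr (1 / 2)) \<le> real n / K\<^sup>2"
      using K2 K0 elim by (intro divide_left_mono mult_pos_pos) auto
    moreover have "real n = real n powr (1 / 2) * real n powr (1 / 2)"
      using elim by (simp flip: powr_add)
    then have "real n / ((2 ^ (l + 3))\<^sup>2 * real n powr (1 / 2)) = real n powr (1 / 2) / (2 ^ (l + 3))\<^sup>2"
      using elim by (simp add: field_simps)
    ultimately have "\<gamma> * (real n powr (1 / 2) / (2 ^ (l + 3))\<^sup>2) \<le> \<gamma> * (real n / K\<^sup>2)"
      using \<gamma> by (intro mult_left_mono) auto
    then have "exp (- \<gamma> * (real n / K\<^sup>2)) \<le> exp (- g * real n powr (1 / 2))"
      by (simp add: g_def)
    moreover have "measure_pmf.prob (erasure_channel n (c / real n))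
            {\<omega>. \<bar>failed_fraction n t l \<omega>
                 - measure_pmf.expectation (erasure_channel n (c / real n)) (failed_fraction n t l)\<bar> \<ge> \<epsilon>}
        \<le> real n * exp (2 * c - real D) + 2 * exp (- \<gamma> * (real n / K\<^sup>2))"
      unfolding erasure_channel_def \<gamma>_def K_def
    proof (rule sparse_graph.failed_fraction_tail[OF elim(1) eps])
      show "real n * exp (2 * c - real D) \<le> \<epsilon> / 2"
        using elim(2) nD unfolding m_def by linarith
    qed
    ultimately show ?case using elim(2) nD unfolding m_def by linarith
  qed
  then obtain n0 where "\<forall>n\<ge>n0. measure_pmf.prob (erasure_channel n (c / real n))
            {\<omega>. \<bar>failed_fraction n t l \<omega>
                 - measure_pmf.expectation (erasure_channel n (c / real n)) (failed_fraction n t l)\<bar> \<ge> \<epsilon>}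
          \<le> exp (- 1 * real n powr \<delta>)"
    unfolding eventually_sequentially by blast
  then show "\<exists>\<delta>>0. \<exists>\<beta>>0. \<exists>n0::nat. \<forall>n>n0.
          measure_pmf.prob (erasure_channel n (c / real n))
            {\<omega>. \<bar>failed_fraction n t l \<omega>
                 - measure_pmf.expectation (erasure_channel n (c / real n)) (failed_fraction n t l)\<bar> \<ge> \<epsilon>}
          \<le> exp (- \<beta> * real n powr \<delta>)"
    using \<delta>(1) by (intro exI[of _ \<delta>] conjI exI[of _ 1] exI[of _ n0]) auto
qed

end
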